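(* Let $R$ be an Abelian d-rag. Then $(\mathbf V^R_m,\eta,\_^\dagger,t)$ is a commutative monad on the category $\mathbf{Dcpo}$ of dcpos and Scott-continuous maps.
   Context: A dcpo is a poset in which every directed family has a supremum; dcpos are always given their Scott topology. A rag is a tuple $(R,0,+,1,\times)$ where $(R,0,+)$ is an Abelian monoid, $(R,1,\times)$ is a monoid, and $\times$ distributes over $+$ (it is not required that $0\times r=0$). It is Abelian if $\times$ is commutative. A d-rag is a rag with an ordering making it a dcpo such that $+$ and $\times$ are Scott-continuous. For a topological space $X$ (a dcpo being given its Scott topology), $\mathcal L^R X$ is the dcpo of all continuous maps $X\to R$ ($R$ with its Scott topology), ordered pointwise. A continuous $R$-valuation on $X$ is a Scott-continuous map $\nu:\mathcal L^R X\to R$ with $\nu(\mathbf a\times h)=\mathbf a\times\nu(h)$ and $\nu(h+h')=\nu(h)+\nu(h')$ for all $\mathbf a\in R$, $h,h'\in\mathcal L^R X$. $\mathbf V^R X$ is the dcpo of all continuous $R$-valuations on $X$ with the pointwise ordering. $\delta_x\in\mathbf V^R X$ is $h\mapsto h(x)$. An elementary $R$-valuation is one of the form $h\mapsto\sum_{i=1}^n r_i\times h(x_i)$ with $n\ge 1$, $r_i\in R$, $x_i\in X$; $\mathbf V^R_{\mathrm f}X$ is the set of these. $\mathbf V^R_m X$ (the minimal $R$-valuations) is the smallest subset of $\mathbf V^R X$ containing $\mathbf V^R_{\mathrm f}X$ and closed under directed suprema, with the induced ordering. Structure on $T=\mathbf V^R_m$: $\eta_X(x)=\delta_x$; for Scott-continuous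 $f:X\to TY$, $f^\dagger(\nu)(k)=\nu(\lambda x\in X.\,f(x)(k))$; the tensorial strength is $t_{X,Y}:X\times TY\to T(X\times Y)$, $t_{X,Y}(x,\nu)(h)=\nu(\lambda y\in Y.\,h(x,y))$; the dual strength is $t'_{X,Y}:TX\times Y\to T(X\times Y)$, $t'_{X,Y}(\mu,y)(h)=\mu(\lambda x\in X.\,h(x,y))$, where $h\in\mathcal L^R(X\times Y)$. A monad (Manes' presentation) is an object map $T$, morphisms $\eta_X:X\to TX$, and for each $f:X\to TY$ a morphism $f^\dagger:TX\to TY$, with $f^\dagger\circ\eta_X=f$, $\eta_X^\dagger=\mathrm{id}_{TX}$, $(g^\dagger\circ f)^\dagger=g^\dagger\circ f^\dagger$. A strong monad $(T,\eta,\_^\dagger,t)$ (a monad with a tensorial strength, i.e. $t$ is natural and satisfies Moggi's usual coherence conditions) is commutative when for all objects $X,Y$ the two morphisms ${t'}^\dagger_{X,Y}\circ t_{TX,Y}$ and $t^\dagger_{X,Y}\circ t'_{X,TY}$ from $TX\times TY$ to $T(X\times Y)$ coincide. *)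

theory Defs
  imports "HOL-Analysis.Abstract_Topology" "HOL-Algebra.Order" "HOL-Library.FuncSet"
begin

section \<open>Dcpos and Scott-continuous maps\<close>

definition directed :: "('a, 'm) gorder_scheme \<Rightarrow> 'a set \<Rightarrow> bool" where
  "directed X D \<longleftrightarrow> D \<subseteq> carrier X \<and> D \<noteq> {} \<and>
     (\<forall>a\<in>D. \<forall>b\<in>D. \<exists>c\<in>D. a \<sqsubseteq>\<^bsub>X\<^esub> c \<and> b \<sqsubseteq>\<^bsub>X\<^esub> c)"

locale dcpo = partial_order L for L :: "'a gorder" (structure) +
  assumes directed_lub: "directed L D \<Longrightarrow> \<exists>s. is_lub L s D"

definition scott_continuous :: "'a gorder \<Rightarrow> 'b gorder \<Rightarrow> ('a \<Rightarrow> 'b) \<Rightarrow> bool" where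
  "scott_continuous X Y f \<longleftrightarrow>
     f \<in> carrier X \<rightarrow> carrier Y \<and>
     (\<forall>a\<in>carrier X. \<forall>b\<in>carrier X. a \<sqsubseteq>\<^bsub>X\<^esub> b \<longrightarrow> f a \<sqsubseteq>\<^bsub>Y\<^esub> f b) \<and>
     (\<forall>D s. directed X D \<and> is_lub X s D \<longrightarrow> is_lub Y (f s) (f ` D))"

definition scott_open :: "'a gorder \<Rightarrow> 'a set \<Rightarrow> bool" where
  "scott_open X U \<longleftrightarrow>
     U \<subseteq> carrier X \<and>
     (\<forall>a\<in>U. \<forall>b\<in>carrier X. a \<sqsubseteq>\<^bsub>X\<^esub> b \<longrightarrow> b \<in> U) \<and>
     (\<forall>D s. directed X D \<and> is_lub X s D \<and> s \<in> U \<longrightarrow> D \<inter> U \<noteq> {})"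

definition scott_topology :: "'a gorder \<Rightarrow> 'a topology" where
  "scott_topology X = topology (scott_open X)"

lemma istopology_scott_open: "istopology (scott_open X)"
  unfolding istopology_def
proof (intro conjI allI impI)
  fix S T assume S: "scott_open X S" and T: "scott_open X T"
  show "scott_open X (S \<inter> T)"
    unfolding scott_open_def
  proof (intro conjI allI impI)
    show "S \<inter> T \<subseteq> carrier X"
      using S by (auto simp: scott_open_def)
    show "\<forall>a\<in>S \<inter> T. \<forall>b\<in>carrier X. a \<sqsubseteq>\<^bsub>X\<^esub> b \<longrightarrow> b \<in> S \<inter> T"
      using S T unfolding scott_open_def by blast
    fix D s assume D: "directed X D \<and> is_lub X s D \<and> s \<in> S \<inter> T"
    obtain a where a: "a \<in> D" "a \<in> S"
      using S D unfolding scott_open_def by blast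
    obtain b where b: "b \<in> D" "b \<in> T"
      using T D unfolding scott_open_def by blast
    obtain c where c: "c \<in> D" "a \<sqsubseteq>\<^bsub>X\<^esub> c" "b \<sqsubseteq>\<^bsub>X\<^esub> c" "c \<in> carrier X"
      using D a b unfolding directed_def by blast
    have "c \<in> S" "c \<in> T"
      using S T a b c unfolding scott_open_def by blast+
    then show "D \<inter> (S \<inter> T) \<noteq> {}"
      using c by blast
  qed
next
  fix K assume K: "\<forall>S\<in>K. scott_open X S"
  show "scott_open X (\<Union>K)"
    unfolding scott_open_def
  proof (intro conjI allI impI)
    show "\<Union>K \<subseteq> carrier X"
      using K by (auto simp: scott_open_def)
    show "\<forall>a\<in>\<Union>K. \<forall>b\<in>carrier X. a \<sqsubseteq>\<^bsub>X\<^esub> b \<longrightarrow> b \<in> \<Union>K"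
      using K unfolding scott_open_def by blast
    fix D s assume D: "directed X D \<and> is_lub X s D \<and> s \<in> \<Union>K"
    then obtain S where "S \<in> K" "s \<in> S" by blast
    then have "D \<inter> S \<noteq> {}"
      using K D unfolding scott_open_def by blast
    then show "D \<inter> \<Union>K \<noteq> {}"
      using \<open>S \<in> K\<close> by blast
  qed
qed

lemma openin_scott_topology [simp]: "openin (scott_topology X) = scott_open X"
  by (simp add: scott_topology_def istopology_scott_open)

lemma topspace_scott_topology [simp]: "topspace (scott_topology X) = carrier X"
proof -
  have "scott_open X (carrier X)"
    unfolding scott_open_def directed_def by blast
  then show ?thesis
    unfolding topspace_def by (auto simp: scott_open_def)
qed

section \<open>The category of dcpos\<close>

text \<open>
  Morphisms are extensional outside the carrier of their domain, so that equality of
  morphisms is HOL equality.  The composite of \<open>f\<close>, with domain \<open>X\<close>, followed by \<open>g\<close> is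
  \<open>compose (carrier X) g f\<close>.
\<close>

definition dcpo_hom :: "'a gorder \<Rightarrow> 'b gorder \<Rightarrow> ('a \<Rightarrow> 'b) set" where
  "dcpo_hom X Y = {f \<in> extensional (carrier X). scott_continuous X Y f}"

definition dcpo_id :: "'a gorder \<Rightarrow> 'a \<Rightarrow> 'a" where
  "dcpo_id X = (\<lambda>x\<in>carrier X. x)"

definition dcpo_unit :: "unit gorder" where
  "dcpo_unit = \<lparr>carrier = UNIV, eq = (=), le = (\<lambda>_ _. True)\<rparr>"

definition dcpo_prod :: "'a gorder \<Rightarrow> 'b gorder \<Rightarrow> ('a \<times> 'b) gorder" (infixr \<open>\<times>\<^sub>D\<close> 80) where
  "X \<times>\<^sub>D Y = \<lparr>carrier = carrier X \<times> carrier Y, eq = (=),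
     le = (\<lambda>p q. fst p \<sqsubseteq>\<^bsub>X\<^esub> fst q \<and> snd p \<sqsubseteq>\<^bsub>Y\<^esub> snd q)\<rparr>"

definition dcpo_prod_map ::
  "'a gorder \<Rightarrow> 'b gorder \<Rightarrow> ('a \<Rightarrow> 'c) \<Rightarrow> ('b \<Rightarrow> 'd) \<Rightarrow> 'a \<times> 'b \<Rightarrow> 'c \<times> 'd" where
  "dcpo_prod_map X Y f g = (\<lambda>(x, y)\<in>carrier (X \<times>\<^sub>D Y). (f x, g y))"

definition dcpo_snd :: "'a gorder \<Rightarrow> 'b gorder \<Rightarrow> 'a \<times> 'b \<Rightarrow> 'b" where
  "dcpo_snd X Y = (\<lambda>(x, y)\<in>carrier (X \<times>\<^sub>D Y). y)"

definition dcpo_assoc ::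
  "'a gorder \<Rightarrow> 'b gorder \<Rightarrow> 'c gorder \<Rightarrow> ('a \<times> 'b) \<times> 'c \<Rightarrow> 'a \<times> 'b \<times> 'c" where
  "dcpo_assoc X Y Z = (\<lambda>((x, y), z)\<in>carrier ((X \<times>\<^sub>D Y) \<times>\<^sub>D Z). (x, (y, z)))"

section \<open>D-rags\<close>

definition type_gorder :: "('a \<Rightarrow> 'a \<Rightarrow> bool) \<Rightarrow> 'a gorder" where
  "type_gorder l = \<lparr>carrier = UNIV, eq = (=), le = l\<rparr>"

text \<open>The library class \<^class>\<open>semiring\<close> does not require \<open>0 * r = 0\<close>.\<close>

class rag = semiring + comm_monoid_add + monoid_mult

class d_rag = rag + order +
  assumes dcpo_le: "dcpo (type_gorder (\<le>))"
    and scott_continuous_plus: "scott_continuous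
      (type_gorder (\<le>) \<times>\<^sub>D type_gorder (\<le>)) (type_gorder (\<le>)) (\<lambda>(a, b). a + b)"
    and scott_continuous_times: "scott_continuous
      (type_gorder (\<le>) \<times>\<^sub>D type_gorder (\<le>)) (type_gorder (\<le>)) (\<lambda>(a, b). a * b)"

class abelian_d_rag = d_rag + ab_semigroup_mult

text \<open>
  A d-rag \<open>R\<close> is a type of class \<open>d_rag\<close>, passed as an \<open>itself\<close> argument; \<open>rag_dcpo R\<close> is its
  underlying dcpo.
\<close>

definition rag_dcpo :: "'r::d_rag itself \<Rightarrow> 'r gorder" where
  "rag_dcpo R = type_gorder (\<le>)"

section \<open>Continuous \<open>R\<close>-valuations\<close>

definition cont_maps :: "'r::d_rag itself \<Rightarrow> 'x topology \<Rightarrow> ('x \<Rightarrow> 'r) gorder" where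
  "cont_maps R X = \<lparr>
     carrier = {h \<in> extensional (topspace X). continuous_map X (scott_topology (rag_dcpo R)) h},
     eq = (=),
     le = (\<lambda>h k. \<forall>x\<in>topspace X. h x \<le> k x)\<rparr>"

definition valuations :: "'r::d_rag itself \<Rightarrow> 'x topology \<Rightarrow> (('x \<Rightarrow> 'r) \<Rightarrow> 'r) gorder" where
  "valuations R X = \<lparr>
     carrier = {\<nu> \<in> dcpo_hom (cont_maps R X) (rag_dcpo R).
       (\<forall>a. \<forall>h\<in>carrier (cont_maps R X). \<nu> (\<lambda>x\<in>topspace X. a * h x) = a * \<nu> h) \<and>
       (\<forall>h\<in>carrier (cont_maps R X). \<forall>k\<in>carrier (cont_maps R X).
          \<nu> (\<lambda>x\<in>topspace X. h x + k x) = \<nu> h + \<nu> k)},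
     eq = (=),
     le = (\<lambda>\<mu> \<nu>. \<forall>h\<in>carrier (cont_maps R X). \<mu> h \<le> \<nu> h)\<rparr>"

definition dirac :: "'r::d_rag itself \<Rightarrow> 'x topology \<Rightarrow> 'x \<Rightarrow> ('x \<Rightarrow> 'r) \<Rightarrow> 'r" where
  "dirac R X x = (\<lambda>h\<in>carrier (cont_maps R X). h x)"

definition elementary_valuations ::
  "'r::d_rag itself \<Rightarrow> 'x topology \<Rightarrow> (('x \<Rightarrow> 'r) \<Rightarrow> 'r) set" where
  "elementary_valuations R X =
     {(\<lambda>h\<in>carrier (cont_maps R X). \<Sum>i=1..n. r i * h (x i)) | (n::nat) r x.
        n \<ge> 1 \<and> (\<forall>i\<in>{1..n}. x i \<in> topspace X)}"

inductive_set minimal_valuations ::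
  "'r::d_rag itself \<Rightarrow> 'x topology \<Rightarrow> (('x \<Rightarrow> 'r) \<Rightarrow> 'r) set"
  for R :: "'r::d_rag itself" and X :: "'x topology" where
  elementary: "\<nu> \<in> elementary_valuations R X \<Longrightarrow> \<nu> \<in> minimal_valuations R X"
| directed_lub: "\<lbrakk>\<forall>d\<in>D. d \<in> minimal_valuations R X; directed (valuations R X) D;
    is_lub (valuations R X) \<nu> D\<rbrakk> \<Longrightarrow> \<nu> \<in> minimal_valuations R X"

section \<open>The structure on minimal valuations over dcpos\<close>

definition Vm :: "'r::d_rag itself \<Rightarrow> 'x gorder \<Rightarrow> (('x \<Rightarrow> 'r) \<Rightarrow> 'r) gorder" where
  "Vm R X = (valuations R (scott_topology X))
     \<lparr>carrier := minimal_valuations R (scott_topology X)\<rparr>"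

definition Vm_unit :: "'r::d_rag itself \<Rightarrow> 'x gorder \<Rightarrow> 'x \<Rightarrow> ('x \<Rightarrow> 'r) \<Rightarrow> 'r" where
  "Vm_unit R X = (\<lambda>x\<in>carrier X. dirac R (scott_topology X) x)"

definition Vm_ext :: "'r::d_rag itself \<Rightarrow> 'x gorder \<Rightarrow> 'y gorder \<Rightarrow>
    ('x \<Rightarrow> ('y \<Rightarrow> 'r) \<Rightarrow> 'r) \<Rightarrow> (('x \<Rightarrow> 'r) \<Rightarrow> 'r) \<Rightarrow> ('y \<Rightarrow> 'r) \<Rightarrow> 'r" where
  "Vm_ext R X Y f = (\<lambda>\<nu>\<in>carrier (Vm R X). \<lambda>k\<in>carrier (cont_maps R (scott_topology Y)).
     \<nu> (\<lambda>x\<in>carrier X. f x k))"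

definition Vm_strength :: "'r::d_rag itself \<Rightarrow> 'x gorder \<Rightarrow> 'y gorder \<Rightarrow>
    'x \<times> (('y \<Rightarrow> 'r) \<Rightarrow> 'r) \<Rightarrow> ('x \<times> 'y \<Rightarrow> 'r) \<Rightarrow> 'r" where
  "Vm_strength R X Y = (\<lambda>(x, \<nu>)\<in>carrier (X \<times>\<^sub>D Vm R Y).
     \<lambda>h\<in>carrier (cont_maps R (scott_topology (X \<times>\<^sub>D Y))). \<nu> (\<lambda>y\<in>carrier Y. h (x, y)))"

definition Vm_dual_strength :: "'r::d_rag itself \<Rightarrow> 'x gorder \<Rightarrow> 'y gorder \<Rightarrow>
    (('x \<Rightarrow> 'r) \<Rightarrow> 'r) \<times> 'y \<Rightarrow> ('x \<times> 'y \<Rightarrow> 'r) \<Rightarrow> 'r" where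
  "Vm_dual_strength R X Y = (\<lambda>(\<mu>, y)\<in>carrier (Vm R X \<times>\<^sub>D Y).
     \<lambda>h\<in>carrier (cont_maps R (scott_topology (X \<times>\<^sub>D Y))). \<mu> (\<lambda>x\<in>carrier X. h (x, y)))"

text \<open>The functor action and the multiplication induced by a Kleisli triple:
  \<open>T f = (\<eta> \<circ> f)\<^sup>\<dagger>\<close> and \<open>\<mu> = id\<^sup>\<dagger>\<close>.\<close>

definition Vm_map :: "'r::d_rag itself \<Rightarrow> 'x gorder \<Rightarrow> 'y gorder \<Rightarrow>
    ('x \<Rightarrow> 'y) \<Rightarrow> (('x \<Rightarrow> 'r) \<Rightarrow> 'r) \<Rightarrow> ('y \<Rightarrow> 'r) \<Rightarrow> 'r" where
  "Vm_map R X Y f = Vm_ext R X Y (compose (carrier X) (Vm_unit R Y) f)"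

definition Vm_mult :: "'r::d_rag itself \<Rightarrow> 'x gorder \<Rightarrow>
    (((('x \<Rightarrow> 'r) \<Rightarrow> 'r) \<Rightarrow> 'r) \<Rightarrow> 'r) \<Rightarrow> ('x \<Rightarrow> 'r) \<Rightarrow> 'r" where
  "Vm_mult R X = Vm_ext R (Vm R X) X (dcpo_id (Vm R X))"

end

theory Submission
  imports Defs
begin

text \<open>
  Continuous maps into \<open>R\<close>, continuous \<open>R\<close>-valuations and minimal \<open>R\<close>-valuations all form dcpos of
  functions in which directed suprema are computed pointwise, so a map into them is Scott-continuous
  as soon as each of its evaluations is.  Extension, unit and strength therefore reduce to pointwise
  computations; the only delicate point is that they preserve minimality.  Since a Scott-continuous
  map sending elementary valuations to minimal ones sends minimal valuations to minimal ones, the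
  minimal valuations are closed under scaling (commutativity of \<open>R\<close> is needed here) and, by two
  successive applications, under addition; hence \<open>f\<^sup>\<dagger>(\<Sum> r\<^sub>i * \<delta>(x\<^sub>i)) = \<Sum> r\<^sub>i * f(x\<^sub>i)\<close>
  is minimal.  Both strengths are functorial images of \<open>\<nu>\<close> under maps \<open>y \<mapsto> (x, y)\<close>.
  Commutativity of the monad is Fubini's formula, which holds for point masses by linearity and is
  stable under sums and directed suprema in \<open>\<mu>\<close>.
\<close>

section \<open>Directed suprema\<close>

text \<open>The library's \<open>Upper\<close> tests only those elements of \<open>D\<close> that
  lie in the carrier. Once \<open>D\<close> is known to be inside the carrier this guard disappears,
  and every later proof about suprema can use the elementwise form.\<close>

lemma is_lub_iff:
  assumes "D \<subseteq> carrier L"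
  shows "is_lub L s D \<longleftrightarrow> s \<in> carrier L \<and> (\<forall>d\<in>D. d \<sqsubseteq>\<^bsub>L\<^esub> s) \<and>
    (\<forall>u\<in>carrier L. (\<forall>d\<in>D. d \<sqsubseteq>\<^bsub>L\<^esub> u) \<longrightarrow> s \<sqsubseteq>\<^bsub>L\<^esub> u)"
proof -
  have "Upper L D = {u \<in> carrier L. \<forall>d\<in>D. d \<sqsubseteq>\<^bsub>L\<^esub> u}"
    using assms unfolding Upper_def by blast
  then show ?thesis
    unfolding least_def by auto
qed

lemma directed_subset: "directed L D \<Longrightarrow> D \<subseteq> carrier L"
  by (simp add: directed_def)

lemmas is_lub_directed_iff = is_lub_iff [OF directed_subset]

text \<open>HOL-Algebra orders carry a setoid equality \<open>eq\<close>. Fixing it to be HOL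
  equality makes the congruence axioms trivial, so that only the three order axioms and directed
  completeness remain to be checked.\<close>

lemma dcpoI:
  assumes "eq L = (=)"
    and "\<And>a. a \<in> carrier L \<Longrightarrow> a \<sqsubseteq>\<^bsub>L\<^esub> a"
    and "\<And>a b. \<lbrakk>a \<in> carrier L; b \<in> carrier L; a \<sqsubseteq>\<^bsub>L\<^esub> b; b \<sqsubseteq>\<^bsub>L\<^esub> a\<rbrakk> \<Longrightarrow> a = b"
    and "\<And>a b c. \<lbrakk>a \<in> carrier L; b \<in> carrier L; c \<in> carrier L; a \<sqsubseteq>\<^bsub>L\<^esub> b; b \<sqsubseteq>\<^bsub>L\<^esub> c\<rbrakk> \<Longrightarrow> a \<sqsubseteq>\<^bsub>L\<^esub> c"
    and "\<And>D. directed L D \<Longrightarrow> \<exists>s. is_lub L s D"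
  shows "dcpo L"
proof unfold_locales
  show "a \<sqsubseteq>\<^bsub>L\<^esub> c" if "a \<in> carrier L" "b \<in> carrier L" "c \<in> carrier L" "a \<sqsubseteq>\<^bsub>L\<^esub> b" "b \<sqsubseteq>\<^bsub>L\<^esub> c" for a b c
    by (rule assms(4)[OF that])
  show "\<exists>s. is_lub L s D" if "directed L D" for D
    using that by (rule assms(5))
qed (simp_all add: assms(1-3))

lemma dcpo_is_partial_order: "dcpo L \<Longrightarrow> partial_order L"
  by (simp add: dcpo_def)

lemma
  assumes "dcpo L" and "a \<in> carrier L"
  shows dcpo_refl: "a \<sqsubseteq>\<^bsub>L\<^esub> a"
    and dcpo_antisym: "\<lbrakk>b \<in> carrier L; a \<sqsubseteq>\<^bsub>L\<^esub> b; b \<sqsubseteq>\<^bsub>L\<^esub> a\<rbrakk> \<Longrightarrow> a = b"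
    and dcpo_trans: "\<lbrakk>b \<in> carrier L; c \<in> carrier L; a \<sqsubseteq>\<^bsub>L\<^esub> b; b \<sqsubseteq>\<^bsub>L\<^esub> c\<rbrakk> \<Longrightarrow> a \<sqsubseteq>\<^bsub>L\<^esub> c"
proof -
  interpret partial_order L
    using assms by (simp add: dcpo_is_partial_order)
  show "a \<sqsubseteq>\<^bsub>L\<^esub> a"
    using assms by simp
  show "\<lbrakk>b \<in> carrier L; a \<sqsubseteq>\<^bsub>L\<^esub> b; b \<sqsubseteq>\<^bsub>L\<^esub> a\<rbrakk> \<Longrightarrow> a = b"
    using assms by (auto intro: le_antisym)
  show "\<lbrakk>b \<in> carrier L; c \<in> carrier L; a \<sqsubseteq>\<^bsub>L\<^esub> b; b \<sqsubseteq>\<^bsub>L\<^esub> c\<rbrakk> \<Longrightarrow> a \<sqsubseteq>\<^bsub>L\<^esub> c"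
    using assms by (auto intro: le_trans)
qed

lemma is_lub_unique: "\<lbrakk>dcpo L; is_lub L s D; is_lub L t D\<rbrakk> \<Longrightarrow> s = t"
  by (rule dcpo_antisym) (auto intro: least_le least_mem)

section \<open>Scott-continuous maps\<close>

text \<open>The last premise gives only half of the preservation of suprema: the value at the
  supremum lies below every upper bound of the image. That it is itself an upper bound follows from
  monotonicity.\<close>

lemma scott_continuousI:
  assumes "\<And>x. x \<in> carrier X \<Longrightarrow> f x \<in> carrier Y"
    and "\<And>a b. \<lbrakk>a \<in> carrier X; b \<in> carrier X; a \<sqsubseteq>\<^bsub>X\<^esub> b\<rbrakk> \<Longrightarrow> f a \<sqsubseteq>\<^bsub>Y\<^esub> f b"
    and "\<And>D s u. \<lbrakk>directed X D; is_lub X s D; s \<in> carrier X; u \<in> carrier Y;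
          \<And>d. d \<in> D \<Longrightarrow> f d \<sqsubseteq>\<^bsub>Y\<^esub> u\<rbrakk> \<Longrightarrow> f s \<sqsubseteq>\<^bsub>Y\<^esub> u"
  shows "scott_continuous X Y f"
  unfolding scott_continuous_def
proof (intro conjI allI impI ballI)
  show "f \<in> carrier X \<rightarrow> carrier Y"
    using assms(1) by blast
  show "f a \<sqsubseteq>\<^bsub>Y\<^esub> f b" if "a \<in> carrier X" "b \<in> carrier X" "a \<sqsubseteq>\<^bsub>X\<^esub> b" for a b
    using assms(2) that .
  fix D s assume D: "directed X D \<and> is_lub X s D"
  then have sub: "D \<subseteq> carrier X"
    by (simp add: directed_subset)
  then have s: "s \<in> carrier X" "\<And>d. d \<in> D \<Longrightarrow> d \<sqsubseteq>\<^bsub>X\<^esub> s"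
    using D by (auto simp: is_lub_iff)
  have "f ` D \<subseteq> carrier Y"
    using sub assms(1) by blast
  then show "is_lub Y (f s) (f ` D)"
    using s sub assms(1,2) assms(3)[of D s] D by (auto simp: is_lub_iff)
qed

lemma
  assumes "scott_continuous X Y f"
  shows scott_continuous_closed: "x \<in> carrier X \<Longrightarrow> f x \<in> carrier Y"
    and scott_continuous_mono: "\<lbrakk>a \<in> carrier X; b \<in> carrier X; a \<sqsubseteq>\<^bsub>X\<^esub> b\<rbrakk> \<Longrightarrow> f a \<sqsubseteq>\<^bsub>Y\<^esub> f b"
    and scott_continuous_lub: "\<lbrakk>directed X D; is_lub X s D\<rbrakk> \<Longrightarrow> is_lub Y (f s) (f ` D)"
  using assms unfolding scott_continuous_def by auto

lemma scott_continuous_lub_le: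
  assumes "scott_continuous X Y f" "directed X D" "is_lub X s D" "u \<in> carrier Y"
    and "\<And>d. d \<in> D \<Longrightarrow> f d \<sqsubseteq>\<^bsub>Y\<^esub> u"
  shows "f s \<sqsubseteq>\<^bsub>Y\<^esub> u"
proof -
  have "f ` D \<subseteq> carrier Y"
    using directed_subset[OF assms(2)] scott_continuous_closed[OF assms(1)] by blast
  then show ?thesis
    using scott_continuous_lub[OF assms(1-3)] assms(4,5) by (simp add: is_lub_iff)
qed

lemma scott_continuous_directed:
  assumes "scott_continuous X Y f" "directed X D"
  shows "directed Y (f ` D)"
  unfolding directed_def
proof (intro conjI ballI)
  have sub: "D \<subseteq> carrier X"
    using assms(2) by (rule directed_subset)
  show "f ` D \<subseteq> carrier Y"
    using sub scott_continuous_closed[OF assms(1)] by blast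
  show "f ` D \<noteq> {}"
    using assms(2) by (simp add: directed_def)
  fix a b assume "a \<in> f ` D" "b \<in> f ` D"
  then obtain a' b' where ab: "a' \<in> D" "a = f a'" "b' \<in> D" "b = f b'"
    by blast
  then obtain c where "c \<in> D" "a' \<sqsubseteq>\<^bsub>X\<^esub> c" "b' \<sqsubseteq>\<^bsub>X\<^esub> c"
    using assms(2) unfolding directed_def by blast
  then show "\<exists>c\<in>f ` D. a \<sqsubseteq>\<^bsub>Y\<^esub> c \<and> b \<sqsubseteq>\<^bsub>Y\<^esub> c"
    using ab sub scott_continuous_mono[OF assms(1)] by blast
qed

text \<open>Both values are the supremum of one and the same image set. This principle carries
  algebraic identities over to directed suprema: linearity of valuations first, Fubini's formula
  later.\<close>

lemma scott_continuous_eq_at_lub: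
  assumes "dcpo Y" "scott_continuous X Y f" "scott_continuous X Y g"
    and "directed X D" "is_lub X s D" "\<And>d. d \<in> D \<Longrightarrow> f d = g d"
  shows "f s = g s"
proof -
  have "f ` D = g ` D"
    using assms(6) by (rule image_cong[OF refl])
  then show ?thesis
    using is_lub_unique[OF assms(1) scott_continuous_lub[OF assms(2,4,5)]]
      scott_continuous_lub[OF assms(3-5)] by simp
qed

lemma scott_continuous_cong:
  assumes "scott_continuous X Y f" "\<And>x. x \<in> carrier X \<Longrightarrow> f x = g x"
  shows "scott_continuous X Y g"
proof (rule scott_continuousI)
  fix D s u assume D: "directed X D" "is_lub X s D" "s \<in> carrier X" "u \<in> carrier Y"
    and u: "\<And>d. d \<in> D \<Longrightarrow> g d \<sqsubseteq>\<^bsub>Y\<^esub> u"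
  have "f d \<sqsubseteq>\<^bsub>Y\<^esub> u" if "d \<in> D" for d
    using u[OF that] assms(2) that directed_subset[OF D(1)] by auto
  then show "g s \<sqsubseteq>\<^bsub>Y\<^esub> u"
    using scott_continuous_lub_le[OF assms(1) D(1,2,4)] assms(2) D(3) by auto
qed (metis assms scott_continuous_closed scott_continuous_mono)+

lemma scott_continuous_comp:
  assumes "scott_continuous X Y f" "scott_continuous Y Z g"
  shows "scott_continuous X Z (\<lambda>x. g (f x))"
proof (rule scott_continuousI)
  fix D s u assume D: "directed X D" "is_lub X s D" "u \<in> carrier Z"
    and u: "\<And>d. d \<in> D \<Longrightarrow> g (f d) \<sqsubseteq>\<^bsub>Z\<^esub> u"
  show "g (f s) \<sqsubseteq>\<^bsub>Z\<^esub> u"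
    using scott_continuous_lub_le[OF assms(2) scott_continuous_directed[OF assms(1) D(1)]
        scott_continuous_lub[OF assms(1) D(1,2)] D(3)] u by blast
qed (meson assms scott_continuous_closed scott_continuous_mono)+

lemma scott_continuous_id: "scott_continuous X X (\<lambda>x. x)"
  by (rule scott_continuousI) (auto simp: is_lub_directed_iff)

lemma scott_continuous_restrict_iff [simp]:
  "scott_continuous X Y (restrict f (carrier X)) = scott_continuous X Y f"
  by (auto intro: scott_continuous_cong)

lemma scott_continuous_imp_continuous_map:
  assumes "scott_continuous X Y f"
  shows "continuous_map (scott_topology X) (scott_topology Y) f"
  unfolding continuous_map_def
proof (intro conjI allI impI)
  show "f \<in> topspace (scott_topology X) \<rightarrow> topspace (scott_topology Y)"
    using assms by (auto simp: scott_continuous_closed)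
  fix U assume "openin (scott_topology Y) U"
  then have U: "scott_open Y U"
    by simp
  have "scott_open X {x \<in> carrier X. f x \<in> U}"
    unfolding scott_open_def
  proof (intro conjI allI impI ballI)
    fix a b assume "a \<in> {x \<in> carrier X. f x \<in> U}" "b \<in> carrier X" "a \<sqsubseteq>\<^bsub>X\<^esub> b"
    then show "b \<in> {x \<in> carrier X. f x \<in> U}"
      using U scott_continuous_mono[OF assms] scott_continuous_closed[OF assms]
      unfolding scott_open_def by blast
  next
    fix D s assume D: "directed X D \<and> is_lub X s D \<and> s \<in> {x \<in> carrier X. f x \<in> U}"
    then have "directed Y (f ` D)" "is_lub Y (f s) (f ` D)"
      using scott_continuous_directed[OF assms] scott_continuous_lub[OF assms] by auto
    then have "f ` D \<inter> U \<noteq> {}"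
      using U D unfolding scott_open_def by blast
    then show "D \<inter> {x \<in> carrier X. f x \<in> U} \<noteq> {}"
      using D directed_subset[of X D] by blast
  qed auto
  then show "openin (scott_topology X) {x \<in> topspace (scott_topology X). f x \<in> U}"
    by simp
qed

text \<open>If a directed supremum is not below \<open>u\<close>, then \<open>u\<close> is not an
  upper bound of the family, so some member already escapes. These sets let Scott-open sets recover
  the order.\<close>

lemma scott_open_not_below:
  assumes "dcpo Y" "u \<in> carrier Y"
  shows "scott_open Y {y \<in> carrier Y. \<not> y \<sqsubseteq>\<^bsub>Y\<^esub> u}"
  unfolding scott_open_def
proof (intro conjI allI impI ballI)
  fix D s assume D: "directed Y D \<and> is_lub Y s D \<and> s \<in> {y \<in> carrier Y. \<not> y \<sqsubseteq>\<^bsub>Y\<^esub> u}"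
  have sub: "D \<subseteq> carrier Y"
    using D by (simp add: directed_subset)
  have "\<exists>d\<in>D. \<not> d \<sqsubseteq>\<^bsub>Y\<^esub> u"
    using D assms(2) unfolding is_lub_iff[OF sub] by blast
  then show "D \<inter> {y \<in> carrier Y. \<not> y \<sqsubseteq>\<^bsub>Y\<^esub> u} \<noteq> {}"
    using sub by blast
next
  fix a b assume "a \<in> {y \<in> carrier Y. \<not> y \<sqsubseteq>\<^bsub>Y\<^esub> u}" "b \<in> carrier Y" "a \<sqsubseteq>\<^bsub>Y\<^esub> b"
  then show "b \<in> {y \<in> carrier Y. \<not> y \<sqsubseteq>\<^bsub>Y\<^esub> u}"
    using assms dcpo_trans[of Y a b u] by blast
qed auto

text \<open>The open sets of \<open>scott_open_not_below\<close> suffice: their preimages, shown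
  open in \<open>pre\<close>, are upward closed, which yields monotonicity, and inaccessible by
  directed suprema, which yields preservation of suprema.\<close>

lemma continuous_map_imp_scott_continuous:
  assumes X: "dcpo X" and Y: "dcpo Y" and f: "continuous_map (scott_topology X) (scott_topology Y) f"
  shows "scott_continuous X Y f"
proof -
  have closed: "f x \<in> carrier Y" if "x \<in> carrier X" for x
    using f that unfolding continuous_map_def by auto
  have pre: "scott_open X {x \<in> carrier X. \<not> f x \<sqsubseteq>\<^bsub>Y\<^esub> u}" if "u \<in> carrier Y" for u
  proof -
    have "scott_open X {x \<in> carrier X. f x \<in> {y \<in> carrier Y. \<not> y \<sqsubseteq>\<^bsub>Y\<^esub> u}}"
      using openin_continuous_map_preimage[OF f, of "{y \<in> carrier Y. \<not> y \<sqsubseteq>\<^bsub>Y\<^esub> u}"]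
        scott_open_not_below[OF Y that] by (simp only: openin_scott_topology topspace_scott_topology)
    also have "{x \<in> carrier X. f x \<in> {y \<in> carrier Y. \<not> y \<sqsubseteq>\<^bsub>Y\<^esub> u}} = {x \<in> carrier X. \<not> f x \<sqsubseteq>\<^bsub>Y\<^esub> u}"
      using closed by blast
    finally show ?thesis .
  qed
  show ?thesis
  proof (rule scott_continuousI)
    fix a b assume ab: "a \<in> carrier X" "b \<in> carrier X" "a \<sqsubseteq>\<^bsub>X\<^esub> b"
    \<comment> \<open>Instance \<open>u = f b\<close>: were \<open>f a\<close> not below
      \<open>f b\<close>, the upward closed preimage would contain \<open>a\<close> and hence
      \<open>b\<close>, against reflexivity.\<close>
    show "f a \<sqsubseteq>\<^bsub>Y\<^esub> f b"
      using pre[OF closed[OF ab(2)]] ab dcpo_refl[OF Y closed[OF ab(2)]]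
      unfolding scott_open_def by blast
  next
    fix D s u assume "directed X D" "is_lub X s D" "s \<in> carrier X" "u \<in> carrier Y"
      "\<And>d. d \<in> D \<Longrightarrow> f d \<sqsubseteq>\<^bsub>Y\<^esub> u"
    then show "f s \<sqsubseteq>\<^bsub>Y\<^esub> u"
      using pre[of u] unfolding scott_open_def by blast
  qed (rule closed)
qed

section \<open>Products\<close>

lemma dcpo_prod_simps [simp]:
  "carrier (X \<times>\<^sub>D Y) = carrier X \<times> carrier Y"
  "eq (X \<times>\<^sub>D Y) = (=)"
  "p \<sqsubseteq>\<^bsub>X \<times>\<^sub>D Y\<^esub> q \<longleftrightarrow> fst p \<sqsubseteq>\<^bsub>X\<^esub> fst q \<and> snd p \<sqsubseteq>\<^bsub>Y\<^esub> snd q"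
  by (simp_all add: dcpo_prod_def)

lemma directed_prodD:
  assumes "directed (X \<times>\<^sub>D Y) D"
  shows "directed X (fst ` D)" "directed Y (snd ` D)"
proof -
  have D: "D \<subseteq> carrier X \<times> carrier Y" "D \<noteq> {}"
    "\<And>a b. \<lbrakk>a \<in> D; b \<in> D\<rbrakk> \<Longrightarrow>
      \<exists>c\<in>D. fst a \<sqsubseteq>\<^bsub>X\<^esub> fst c \<and> snd a \<sqsubseteq>\<^bsub>Y\<^esub> snd c \<and> fst b \<sqsubseteq>\<^bsub>X\<^esub> fst c \<and> snd b \<sqsubseteq>\<^bsub>Y\<^esub> snd c"
    using assms by (simp_all add: directed_def)
  have "\<exists>c\<in>D. fst a \<sqsubseteq>\<^bsub>X\<^esub> fst c \<and> fst b \<sqsubseteq>\<^bsub>X\<^esub> fst c" if "a \<in> D" "b \<in> D" for a b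
    using D(3)[OF that] by blast
  moreover have "\<exists>c\<in>D. snd a \<sqsubseteq>\<^bsub>Y\<^esub> snd c \<and> snd b \<sqsubseteq>\<^bsub>Y\<^esub> snd c" if "a \<in> D" "b \<in> D" for a b
    using D(3)[OF that] by blast
  moreover have "fst ` D \<subseteq> carrier X" "snd ` D \<subseteq> carrier Y"
    using D(1) by auto
  ultimately show "directed X (fst ` D)" "directed Y (snd ` D)"
    using D(2) unfolding directed_def by simp_all
qed

text \<open>To isolate one coordinate from left to right, an upper bound of one projection is paired
  with the component of \<open>s\<close> in the other coordinate.\<close>

lemma is_lub_prod_iff:
  assumes "directed (X \<times>\<^sub>D Y) D"
  shows "is_lub (X \<times>\<^sub>D Y) s D \<longleftrightarrow> is_lub X (fst s) (fst ` D) \<and> is_lub Y (snd s) (snd ` D)"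
proof -
  have "is_lub (X \<times>\<^sub>D Y) s D \<longleftrightarrow> s \<in> carrier X \<times> carrier Y \<and>
      (\<forall>d\<in>D. fst d \<sqsubseteq>\<^bsub>X\<^esub> fst s \<and> snd d \<sqsubseteq>\<^bsub>Y\<^esub> snd s) \<and>
      (\<forall>a\<in>carrier X. \<forall>b\<in>carrier Y. (\<forall>d\<in>D. fst d \<sqsubseteq>\<^bsub>X\<^esub> a \<and> snd d \<sqsubseteq>\<^bsub>Y\<^esub> b) \<longrightarrow>
        fst s \<sqsubseteq>\<^bsub>X\<^esub> a \<and> snd s \<sqsubseteq>\<^bsub>Y\<^esub> b)"
    using is_lub_directed_iff[OF assms] by auto
  also have "\<dots> \<longleftrightarrow> is_lub X (fst s) (fst ` D) \<and> is_lub Y (snd s) (snd ` D)"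
    unfolding is_lub_directed_iff[OF directed_prodD(1)[OF assms]]
      is_lub_directed_iff[OF directed_prodD(2)[OF assms]]
    by (cases s) (simp, blast)
  finally show ?thesis .
qed

lemma dcpo_prod:
  assumes X: "dcpo X" and Y: "dcpo Y"
  shows "dcpo (X \<times>\<^sub>D Y)"
proof (rule dcpoI)
  fix D assume D: "directed (X \<times>\<^sub>D Y) D"
  obtain a b where "is_lub X a (fst ` D)" "is_lub Y b (snd ` D)"
    using dcpo.directed_lub[OF X directed_prodD(1)[OF D]] dcpo.directed_lub[OF Y directed_prodD(2)[OF D]]
    by blast
  then show "\<exists>s. is_lub (X \<times>\<^sub>D Y) s D"
    by (intro exI[of _ "(a, b)"]) (simp add: is_lub_prod_iff[OF D])
next
  fix a b c
  assume "a \<in> carrier (X \<times>\<^sub>D Y)" "b \<in> carrier (X \<times>\<^sub>D Y)" "c \<in> carrier (X \<times>\<^sub>D Y)"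
    "a \<sqsubseteq>\<^bsub>X \<times>\<^sub>D Y\<^esub> b" "b \<sqsubseteq>\<^bsub>X \<times>\<^sub>D Y\<^esub> c"
  then show "a \<sqsubseteq>\<^bsub>X \<times>\<^sub>D Y\<^esub> c"
    using dcpo_trans[OF X, of "fst a" "fst b" "fst c"] dcpo_trans[OF Y, of "snd a" "snd b" "snd c"]
    by auto
qed (auto simp: dcpo_refl[OF X] dcpo_refl[OF Y] dcpo_antisym[OF X] dcpo_antisym[OF Y])

lemma scott_continuous_pair:
  assumes "scott_continuous W X f" "scott_continuous W Y g"
  shows "scott_continuous W (X \<times>\<^sub>D Y) (\<lambda>w. (f w, g w))"
  by (rule scott_continuousI)
    (use assms in \<open>auto dest: scott_continuous_closed scott_continuous_mono
      intro: scott_continuous_lub_le\<close>)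

lemma scott_continuous_fst: "scott_continuous (X \<times>\<^sub>D Y) X fst"
proof (rule scott_continuousI)
  fix D s u
  assume D: "directed (X \<times>\<^sub>D Y) D" "is_lub (X \<times>\<^sub>D Y) s D" "u \<in> carrier X"
    "\<And>d. d \<in> D \<Longrightarrow> fst d \<sqsubseteq>\<^bsub>X\<^esub> u"
  then show "fst s \<sqsubseteq>\<^bsub>X\<^esub> u"
    by (simp add: is_lub_prod_iff is_lub_directed_iff[OF directed_prodD(1)[OF D(1)]])
qed auto

lemma scott_continuous_snd: "scott_continuous (X \<times>\<^sub>D Y) Y snd"
proof (rule scott_continuousI)
  fix D s u
  assume D: "directed (X \<times>\<^sub>D Y) D" "is_lub (X \<times>\<^sub>D Y) s D" "u \<in> carrier Y"
    "\<And>d. d \<in> D \<Longrightarrow> snd d \<sqsubseteq>\<^bsub>Y\<^esub> u"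
  then show "snd s \<sqsubseteq>\<^bsub>Y\<^esub> u"
    by (simp add: is_lub_prod_iff is_lub_directed_iff[OF directed_prodD(2)[OF D(1)]])
qed auto

lemma scott_continuous_const: "\<lbrakk>dcpo Y; c \<in> carrier Y\<rbrakk> \<Longrightarrow> scott_continuous X Y (\<lambda>_. c)"
  by (rule scott_continuousI) (auto simp: dcpo_refl directed_def)

text \<open>Separate Scott continuity implies joint Scott continuity: a directed supremum in the
  product is computed as two successive suprema, one per coordinate.\<close>

lemma scott_continuous_prodI:
  assumes Z: "dcpo Z"
    and fst: "\<And>y. y \<in> carrier Y \<Longrightarrow> scott_continuous X Z (\<lambda>x. f (x, y))"
    and snd: "\<And>x. x \<in> carrier X \<Longrightarrow> scott_continuous Y Z (\<lambda>y. f (x, y))"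
  shows "scott_continuous (X \<times>\<^sub>D Y) Z f"
proof -
  have closed: "f (x, y) \<in> carrier Z" if "x \<in> carrier X" "y \<in> carrier Y" for x y
    using scott_continuous_closed[OF fst[OF that(2)] that(1)] .
  have mono: "f (x, y) \<sqsubseteq>\<^bsub>Z\<^esub> f (x', y')"
    if "x \<in> carrier X" "y \<in> carrier Y" "x' \<in> carrier X" "y' \<in> carrier Y" "x \<sqsubseteq>\<^bsub>X\<^esub> x'" "y \<sqsubseteq>\<^bsub>Y\<^esub> y'"
    for x y x' y'
  proof -
    have "f (x, y) \<sqsubseteq>\<^bsub>Z\<^esub> f (x', y)"
      using scott_continuous_mono[OF fst[OF that(2)] that(1,3,5)] .
    moreover have "f (x', y) \<sqsubseteq>\<^bsub>Z\<^esub> f (x', y')"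
      using scott_continuous_mono[OF snd[OF that(3)] that(2,4,6)] .
    ultimately show ?thesis
      by (rule dcpo_trans[OF Z closed closed closed, rotated -2]) (use that in auto)
  qed
  show ?thesis
  proof (rule scott_continuousI)
    fix D s u assume D: "directed (X \<times>\<^sub>D Y) D" "is_lub (X \<times>\<^sub>D Y) s D" "s \<in> carrier (X \<times>\<^sub>D Y)"
      and u: "u \<in> carrier Z" "\<And>d. d \<in> D \<Longrightarrow> f d \<sqsubseteq>\<^bsub>Z\<^esub> u"
    note D12 = directed_prodD[OF D(1)]
    have lubs: "is_lub X (fst s) (fst ` D)" "is_lub Y (snd s) (snd ` D)"
      using D by (simp_all add: is_lub_prod_iff)
    have sub: "D \<subseteq> carrier X \<times> carrier Y"
      using directed_subset[OF D(1)] by simp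
    \<comment> \<open>The pair \<open>(a, b)\<close> mixes coordinates of two members of
      \<open>D\<close> and need not belong to \<open>D\<close>, but directedness supplies a member
      \<open>r\<close> above it.\<close>
    have "f (a, b) \<sqsubseteq>\<^bsub>Z\<^esub> u" if ab: "a \<in> fst ` D" "b \<in> snd ` D" for a b
    proof -
      obtain p q where "p \<in> D" "a = fst p" "q \<in> D" "b = snd q"
        using ab by blast
      moreover from this obtain r where "r \<in> D" "p \<sqsubseteq>\<^bsub>X \<times>\<^sub>D Y\<^esub> r" "q \<sqsubseteq>\<^bsub>X \<times>\<^sub>D Y\<^esub> r"
        using D(1) unfolding directed_def by blast
      ultimately have r: "r \<in> D" "a \<in> carrier X" "b \<in> carrier Y" "fst r \<in> carrier X" "snd r \<in> carrier Y"
        "a \<sqsubseteq>\<^bsub>X\<^esub> fst r" "b \<sqsubseteq>\<^bsub>Y\<^esub> snd r"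
        using sub by auto
      then have "f (a, b) \<sqsubseteq>\<^bsub>Z\<^esub> f r"
        using mono[of a b "fst r" "snd r"] by simp
      then show ?thesis
        using u(2)[OF r(1)] dcpo_trans[OF Z, of "f (a, b)" "f r" u] closed[of a b]
          closed[of "fst r" "snd r"] r u(1) by simp
    qed
    \<comment> \<open>First the supremum in the second coordinate with \<open>a\<close> fixed, then
      the supremum in the first.\<close>
    then have "f (a, snd s) \<sqsubseteq>\<^bsub>Z\<^esub> u" if "a \<in> fst ` D" for a
      using scott_continuous_lub_le[OF snd D12(2) lubs(2) u(1), of a] that directed_subset[OF D12(1)]
      by auto
    then have "f (fst s, snd s) \<sqsubseteq>\<^bsub>Z\<^esub> u"
      using scott_continuous_lub_le[OF fst D12(1) lubs(1) u(1), of "snd s"] D(3) by auto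
    then show "f s \<sqsubseteq>\<^bsub>Z\<^esub> u"
      by simp
  qed (auto simp: closed mono)
qed

section \<open>D-rags\<close>

lemma rag_dcpo_simps [simp]:
  "carrier (rag_dcpo R) = UNIV" "eq (rag_dcpo R) = (=)" "le (rag_dcpo R) = (\<le>)"
  by (simp_all add: rag_dcpo_def type_gorder_def)

lemma dcpo_rag: "dcpo (rag_dcpo R)"
  by (simp add: rag_dcpo_def dcpo_le)

lemma scott_continuous_add:
  fixes R :: "'r::d_rag itself"
  assumes "scott_continuous X (rag_dcpo R) f" "scott_continuous X (rag_dcpo R) g"
  shows "scott_continuous X (rag_dcpo R) (\<lambda>x. f x + g x)"
proof -
  have "scott_continuous (rag_dcpo R \<times>\<^sub>D rag_dcpo R) (rag_dcpo R) (\<lambda>(a, b). a + b)"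
    by (simp add: rag_dcpo_def scott_continuous_plus)
  from scott_continuous_comp[OF scott_continuous_pair[OF assms] this] show ?thesis
    by simp
qed

lemma scott_continuous_mult_left:
  fixes R :: "'r::d_rag itself"
  assumes "scott_continuous X (rag_dcpo R) f"
  shows "scott_continuous X (rag_dcpo R) (\<lambda>x. a * f x)"
proof -
  have "scott_continuous (rag_dcpo R \<times>\<^sub>D rag_dcpo R) (rag_dcpo R) (\<lambda>(a, b). a * b)"
    by (simp add: rag_dcpo_def scott_continuous_times)
  from scott_continuous_comp[OF scott_continuous_pair[OF scott_continuous_const[OF dcpo_rag] assms] this]
  show ?thesis
    by simp
qed

section \<open>Dcpos of functions ordered pointwise\<close>

text \<open>Common abstraction of the continuous maps, the valuations and the minimal valuations.
  \<open>I\<close> is the set of arguments on which elements are compared; the last assumption is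
  the only one that takes real work in each instance.\<close>

locale pointwise_dcpo =
  fixes P :: "('i \<Rightarrow> 'r::d_rag) gorder" and I :: "'i set" and R :: "'r itself"
  assumes eq_pointwise: "eq P = (=)"
    and le_pointwise: "f \<sqsubseteq>\<^bsub>P\<^esub> g \<longleftrightarrow> (\<forall>i\<in>I. f i \<le> g i)"
    and carrier_extensional: "f \<in> carrier P \<Longrightarrow> f \<in> extensional I"
    and pointwise_lub_closed: "\<lbrakk>directed P D; s \<in> extensional I;
      \<And>i. i \<in> I \<Longrightarrow> is_lub (rag_dcpo R) (s i) ((\<lambda>f. f i) ` D)\<rbrakk> \<Longrightarrow> s \<in> carrier P"
begin

lemma pointwise_eqI: "\<lbrakk>f \<in> carrier P; g \<in> carrier P; \<And>i. i \<in> I \<Longrightarrow> f i = g i\<rbrakk> \<Longrightarrow> f = g"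
  using carrier_extensional extensionalityI by blast

lemma directed_eval: "\<lbrakk>directed P D; i \<in> I\<rbrakk> \<Longrightarrow> directed (rag_dcpo R) ((\<lambda>f. f i) ` D)"
  unfolding directed_def le_pointwise rag_dcpo_simps ball_simps bex_simps by blast

lemma pointwise_is_lubI:
  assumes D: "directed P D" and s: "s \<in> carrier P"
    "\<And>i. i \<in> I \<Longrightarrow> is_lub (rag_dcpo R) (s i) ((\<lambda>f. f i) ` D)"
  shows "is_lub P s D"
proof -
  have "(\<forall>d\<in>D. d i \<le> s i) \<and> (\<forall>u. (\<forall>d\<in>D. d i \<le> u) \<longrightarrow> s i \<le> u)" if "i \<in> I" for i
    using s(2)[OF that] by (simp add: is_lub_iff)
  then show ?thesis
    using s(1) by (simp add: is_lub_directed_iff[OF D] le_pointwise)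
qed

lemma pointwise_lub_ex:
  assumes D: "directed P D"
  shows "\<exists>s\<in>carrier P. \<forall>i\<in>I. is_lub (rag_dcpo R) (s i) ((\<lambda>f. f i) ` D)"
proof -
  have "\<forall>i\<in>I. \<exists>t. is_lub (rag_dcpo R) t ((\<lambda>f. f i) ` D)"
    using dcpo.directed_lub[OF dcpo_rag directed_eval[OF D]] by blast
  then obtain s where s: "\<forall>i\<in>I. is_lub (rag_dcpo R) (s i) ((\<lambda>f. f i) ` D)"
    by metis
  show ?thesis
  proof (rule bexI)
    \<comment> \<open>The chosen suprema say nothing about \<open>s\<close> outside
      \<open>I\<close>; the restriction makes the witness extensional, as
      \<open>pointwise_lub_closed\<close> demands.\<close>
    show "restrict s I \<in> carrier P"
      by (rule pointwise_lub_closed[OF D]) (use s in auto)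
  qed (use s in auto)
qed

lemma dcpo_pointwise: "dcpo P"
proof (rule dcpoI)
  fix D assume D: "directed P D"
  obtain s where "s \<in> carrier P" "\<forall>i\<in>I. is_lub (rag_dcpo R) (s i) ((\<lambda>f. f i) ` D)"
    using pointwise_lub_ex[OF D] by (rule bexE)
  then have "is_lub P s D"
    by (intro pointwise_is_lubI[OF D]) simp_all
  then show "\<exists>s. is_lub P s D" by blast
next
  fix a b c assume "a \<sqsubseteq>\<^bsub>P\<^esub> b" "b \<sqsubseteq>\<^bsub>P\<^esub> c"
  then show "a \<sqsubseteq>\<^bsub>P\<^esub> c"
    using order_trans unfolding le_pointwise by blast
next
  fix a b assume "a \<in> carrier P" "b \<in> carrier P" "a \<sqsubseteq>\<^bsub>P\<^esub> b" "b \<sqsubseteq>\<^bsub>P\<^esub> a"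
  then show "a = b"
    by (intro pointwise_eqI antisym) (simp_all add: le_pointwise)
qed (auto simp: eq_pointwise le_pointwise)

text \<open>A pointwise supremum exists in \<open>P\<close> and is a supremum there, so by
  uniqueness any supremum in \<open>P\<close> is the pointwise one.\<close>

lemma is_lub_eval:
  assumes D: "directed P D" "is_lub P s D" and i: "i \<in> I"
  shows "is_lub (rag_dcpo R) (s i) ((\<lambda>f. f i) ` D)"
proof -
  obtain t where t: "t \<in> carrier P" "\<forall>i\<in>I. is_lub (rag_dcpo R) (t i) ((\<lambda>f. f i) ` D)"
    using pointwise_lub_ex[OF D(1)] by (rule bexE)
  have "is_lub P t D"
    using t by (intro pointwise_is_lubI[OF D(1)]) simp_all
  then have "s = t"
    by (rule is_lub_unique[OF dcpo_pointwise D(2)])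
  then show ?thesis
    using t(2) i by simp
qed

lemma scott_continuous_eval: "i \<in> I \<Longrightarrow> scott_continuous P (rag_dcpo R) (\<lambda>f. f i)"
  unfolding scott_continuous_def by (simp add: is_lub_eval le_pointwise)

lemma scott_continuous_pointwiseI:
  assumes "\<And>w. w \<in> carrier W \<Longrightarrow> F w \<in> carrier P"
    and "\<And>i. i \<in> I \<Longrightarrow> scott_continuous W (rag_dcpo R) (\<lambda>w. F w i)"
  shows "scott_continuous W P F"
proof (rule scott_continuousI)
  fix D s u assume "directed W D" "is_lub W s D" "\<And>d. d \<in> D \<Longrightarrow> F d \<sqsubseteq>\<^bsub>P\<^esub> u"
  then show "F s \<sqsubseteq>\<^bsub>P\<^esub> u"
    unfolding le_pointwise
    using scott_continuous_lub_le[OF assms(2)] by simp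
next
  fix a b assume "a \<in> carrier W" "b \<in> carrier W" "a \<sqsubseteq>\<^bsub>W\<^esub> b"
  then show "F a \<sqsubseteq>\<^bsub>P\<^esub> F b"
    using scott_continuous_mono[OF assms(2)] by (simp add: le_pointwise)
qed (rule assms(1))

lemma scott_continuous_evalI:
  "\<lbrakk>scott_continuous W P F; i \<in> I\<rbrakk> \<Longrightarrow> scott_continuous W (rag_dcpo R) (\<lambda>w. F w i)"
  by (rule scott_continuous_comp[OF _ scott_continuous_eval])

end

text \<open>Interchange of suprema: a bound of \<open>s\<close> on a directed set also bounds every
  member of \<open>F\<close> there, hence bounds its value at the supremum by continuity, and
  \<open>s\<close> takes the least such bound.\<close>

lemma scott_continuous_pointwise_lub:
  fixes R :: "'r::d_rag itself"
  assumes F: "\<And>f. f \<in> F \<Longrightarrow> scott_continuous X (rag_dcpo R) f"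
    and s: "\<And>x. x \<in> carrier X \<Longrightarrow> is_lub (rag_dcpo R) (s x) ((\<lambda>f. f x) ` F)"
  shows "scott_continuous X (rag_dcpo R) s"
proof -
  have ub: "f x \<le> s x" if "f \<in> F" "x \<in> carrier X" for f x
    using s[OF that(2)] that(1) by (simp add: is_lub_iff)
  have least: "s x \<le> u" if "x \<in> carrier X" "\<And>f. f \<in> F \<Longrightarrow> f x \<le> u" for x u
    using s[OF that(1)] that(2) by (simp add: is_lub_iff)
  show ?thesis
  proof (rule scott_continuousI, unfold rag_dcpo_simps)
    fix a b assume ab: "a \<in> carrier X" "b \<in> carrier X" "a \<sqsubseteq>\<^bsub>X\<^esub> b"
    show "s a \<le> s b"
    proof (rule least[OF ab(1)])
      fix f assume f: "f \<in> F"
      show "f a \<le> s b"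
        using scott_continuous_mono[OF F[OF f] ab] ub[OF f ab(2)] by simp
    qed
  next
    fix D t u assume D: "directed X D" "is_lub X t D" "t \<in> carrier X" and u: "\<And>d. d \<in> D \<Longrightarrow> s d \<le> u"
    show "s t \<le> u"
    proof (rule least[OF D(3)])
      fix f assume f: "f \<in> F"
      have "f d \<le> u" if "d \<in> D" for d
        using ub[OF f] u[OF that] directed_subset[OF D(1)] that order_trans by blast
      then show "f t \<le> u"
        using scott_continuous_lub_le[OF F[OF f] D(1,2), of u] by simp
    qed
  qed simp
qed

section \<open>Spaces of continuous maps and of valuations\<close>

abbreviation fun_dcpo :: "'r::d_rag itself \<Rightarrow> 'x gorder \<Rightarrow> ('x \<Rightarrow> 'r) gorder" where
  "fun_dcpo R X \<equiv> cont_maps R (scott_topology X)"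

abbreviation val_dcpo :: "'r::d_rag itself \<Rightarrow> 'x gorder \<Rightarrow> (('x \<Rightarrow> 'r) \<Rightarrow> 'r) gorder" where
  "val_dcpo R X \<equiv> valuations R (scott_topology X)"

text \<open>Bridge from topology to order: over a dcpo, topological continuity into \<open>R\<close>
  becomes order-theoretic Scott continuity, which is the form used in the subsequent
  arguments.\<close>

lemma carrier_fun_dcpo:
  assumes "dcpo X"
  shows "carrier (fun_dcpo R X) = {h \<in> extensional (carrier X). scott_continuous X (rag_dcpo R) h}"
  unfolding cont_maps_def
  using scott_continuous_imp_continuous_map[of X "rag_dcpo R"]
    continuous_map_imp_scott_continuous[OF assms dcpo_rag[of R]]
  by auto

lemma fun_dcpo_scott_continuous:
  "\<lbrakk>dcpo X; h \<in> carrier (fun_dcpo R X)\<rbrakk> \<Longrightarrow> scott_continuous X (rag_dcpo R) h"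
  by (simp add: carrier_fun_dcpo)

lemma restrict_in_fun_dcpo:
  "\<lbrakk>dcpo X; scott_continuous X (rag_dcpo R) h\<rbrakk> \<Longrightarrow> restrict h (carrier X) \<in> carrier (fun_dcpo R X)"
  by (simp add: carrier_fun_dcpo)

lemma fun_dcpo_restrict: "h \<in> carrier (fun_dcpo R X) \<Longrightarrow> restrict h (carrier X) = h"
  by (simp add: cont_maps_def extensional_restrict)

lemma pointwise_fun_dcpo:
  assumes "dcpo X"
  shows "pointwise_dcpo (fun_dcpo R X) (carrier X) R"
proof
  fix D s assume D: "directed (fun_dcpo R X) D" "s \<in> extensional (carrier X)"
    and s: "\<And>x. x \<in> carrier X \<Longrightarrow> is_lub (rag_dcpo R) (s x) ((\<lambda>f. f x) ` D)"
  have "scott_continuous X (rag_dcpo R) s"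
    using scott_continuous_pointwise_lub[OF _ s] directed_subset[OF D(1)]
      fun_dcpo_scott_continuous[OF assms] by blast
  then show "s \<in> carrier (fun_dcpo R X)"
    using D(2) by (simp add: carrier_fun_dcpo[OF assms])
qed (simp_all add: cont_maps_def)

lemma dcpo_fun_dcpo: "dcpo X \<Longrightarrow> dcpo (fun_dcpo R X)"
  by (rule pointwise_dcpo.dcpo_pointwise[OF pointwise_fun_dcpo])

lemma fun_dcpo_scale:
  "\<lbrakk>dcpo X; h \<in> carrier (fun_dcpo R X)\<rbrakk> \<Longrightarrow> (\<lambda>x\<in>carrier X. a * h x) \<in> carrier (fun_dcpo R X)"
  by (intro restrict_in_fun_dcpo scott_continuous_mult_left fun_dcpo_scott_continuous)

lemma fun_dcpo_plus:
  "\<lbrakk>dcpo X; h \<in> carrier (fun_dcpo R X); k \<in> carrier (fun_dcpo R X)\<rbrakk> \<Longrightarrow>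
    (\<lambda>x\<in>carrier X. h x + k x) \<in> carrier (fun_dcpo R X)"
  by (intro restrict_in_fun_dcpo scott_continuous_add fun_dcpo_scott_continuous)

section \<open>Valuations: linearity, directed suprema and dependence on parameters\<close>

lemma valuation_iff:
  "\<nu> \<in> carrier (val_dcpo R X) \<longleftrightarrow>
    \<nu> \<in> extensional (carrier (fun_dcpo R X)) \<and> scott_continuous (fun_dcpo R X) (rag_dcpo R) \<nu> \<and>
    (\<forall>a. \<forall>h\<in>carrier (fun_dcpo R X). \<nu> (\<lambda>x\<in>carrier X. a * h x) = a * \<nu> h) \<and>
    (\<forall>h\<in>carrier (fun_dcpo R X). \<forall>k\<in>carrier (fun_dcpo R X).
      \<nu> (\<lambda>x\<in>carrier X. h x + k x) = \<nu> h + \<nu> k)"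
  by (simp add: valuations_def dcpo_hom_def)

lemma valuation_scott_continuous:
  "\<nu> \<in> carrier (val_dcpo R X) \<Longrightarrow> scott_continuous (fun_dcpo R X) (rag_dcpo R) \<nu>"
  by (simp add: valuation_iff)

text \<open>The defining clause speaks of extensional integrands. This version takes any
  Scott-continuous \<open>h\<close>, so that it applies directly to sections such as
  \<open>h (x, y)\<close> with one variable fixed.\<close>

lemma valuation_scale:
  assumes "\<nu> \<in> carrier (val_dcpo R X)" "dcpo X" "scott_continuous X (rag_dcpo R) h"
  shows "\<nu> (\<lambda>x\<in>carrier X. a * h x) = a * \<nu> (\<lambda>x\<in>carrier X. h x)"
proof -
  have "\<nu> (\<lambda>x\<in>carrier X. a * restrict h (carrier X) x) = a * \<nu> (\<lambda>x\<in>carrier X. h x)"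
    using assms(1) restrict_in_fun_dcpo[OF assms(2,3)] unfolding valuation_iff by blast
  then show ?thesis
    by (simp cong: restrict_cong)
qed

lemma valuation_plus:
  assumes "\<nu> \<in> carrier (val_dcpo R X)" "dcpo X"
    and "scott_continuous X (rag_dcpo R) h" "scott_continuous X (rag_dcpo R) k"
  shows "\<nu> (\<lambda>x\<in>carrier X. h x + k x) = \<nu> (\<lambda>x\<in>carrier X. h x) + \<nu> (\<lambda>x\<in>carrier X. k x)"
proof -
  have "\<nu> (\<lambda>x\<in>carrier X. restrict h (carrier X) x + restrict k (carrier X) x) =
      \<nu> (\<lambda>x\<in>carrier X. h x) + \<nu> (\<lambda>x\<in>carrier X. k x)"
    using assms(1) restrict_in_fun_dcpo[OF assms(2,3)] restrict_in_fun_dcpo[OF assms(2,4)]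
    unfolding valuation_iff by blast
  then show ?thesis
    by (simp cong: restrict_cong)
qed

text \<open>Valuations are Scott-continuous maps on \<open>fun_dcpo R X\<close>, where pointwise
  directed suprema stay continuous. Linearity survives because both sides of each linear equation
  depend Scott-continuously on the functional.\<close>

lemma pointwise_val_dcpo:
  assumes X: "dcpo X"
  shows "pointwise_dcpo (val_dcpo R X) (carrier (fun_dcpo R X)) R"
proof
  fix D s assume D: "directed (val_dcpo R X) D" and ext: "s \<in> extensional (carrier (fun_dcpo R X))"
    and s: "\<And>h. h \<in> carrier (fun_dcpo R X) \<Longrightarrow> is_lub (rag_dcpo R) (s h) ((\<lambda>\<nu>. \<nu> h) ` D)"
  note FX = dcpo_fun_dcpo[OF X]
  interpret F: pointwise_dcpo "fun_dcpo R (fun_dcpo R X)" "carrier (fun_dcpo R X)" R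
    by (rule pointwise_fun_dcpo[OF FX])
  have sub: "D \<subseteq> carrier (val_dcpo R X)"
    by (rule directed_subset[OF D])
  \<comment> \<open>The order on valuations is the order of the larger space
    \<open>fun_dcpo R (fun_dcpo R X)\<close>, so directedness can be transported there, where
    \<open>s\<close> is already known to be a supremum.\<close>
  have D': "directed (fun_dcpo R (fun_dcpo R X)) D"
    using D unfolding directed_def
    by (auto simp: carrier_fun_dcpo[OF FX] valuation_iff) (simp add: valuations_def cont_maps_def)
  have s': "s \<in> carrier (fun_dcpo R (fun_dcpo R X))"
    by (rule F.pointwise_lub_closed[OF D' ext s])
  have lub: "is_lub (fun_dcpo R (fun_dcpo R X)) s D"
    by (rule F.pointwise_is_lubI[OF D' s' s])
  note eqI = scott_continuous_eq_at_lub[OF dcpo_rag _ _ D' lub]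
  \<comment> \<open>For fixed \<open>a\<close> and \<open>h\<close>, each side is an evaluation or a
    multiple of one; they agree on \<open>D\<close>, hence at \<open>s\<close>.\<close>
  have "s (\<lambda>x\<in>carrier X. a * h x) = a * s h" if "h \<in> carrier (fun_dcpo R X)" for a h
    by (rule eqI[OF F.scott_continuous_eval scott_continuous_mult_left[OF F.scott_continuous_eval]])
      (use that sub fun_dcpo_scale[OF X] in \<open>auto simp: valuation_iff\<close>)
  moreover have "s (\<lambda>x\<in>carrier X. h x + k x) = s h + s k"
    if "h \<in> carrier (fun_dcpo R X)" "k \<in> carrier (fun_dcpo R X)" for h k
    by (rule eqI[OF F.scott_continuous_eval
          scott_continuous_add[OF F.scott_continuous_eval F.scott_continuous_eval]])
      (use that sub fun_dcpo_plus[OF X] in \<open>auto simp: valuation_iff\<close>)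
  ultimately show "s \<in> carrier (val_dcpo R X)"
    using ext fun_dcpo_scott_continuous[OF FX s'] by (simp add: valuation_iff)
qed (simp_all add: valuations_def dcpo_hom_def)

text \<open>Continuity of an integral in a parameter. The map factors through
  \<open>fun_dcpo R Y\<close>: continuity in \<open>y\<close> places each \<open>h w\<close> there,
  and continuity in \<open>w\<close> is tested on evaluations.\<close>

lemma scott_continuous_valuation_comp:
  assumes Y: "dcpo Y" and \<nu>: "\<nu> \<in> carrier (val_dcpo R Y)"
    and "\<And>w. w \<in> carrier W \<Longrightarrow> scott_continuous Y (rag_dcpo R) (h w)"
    and "\<And>y. y \<in> carrier Y \<Longrightarrow> scott_continuous W (rag_dcpo R) (\<lambda>w. h w y)"
  shows "scott_continuous W (rag_dcpo R) (\<lambda>w. \<nu> (\<lambda>y\<in>carrier Y. h w y))"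
proof (rule scott_continuous_comp[OF _ valuation_scott_continuous[OF \<nu>]])
  show "scott_continuous W (fun_dcpo R Y) (\<lambda>w. \<lambda>y\<in>carrier Y. h w y)"
    by (rule pointwise_dcpo.scott_continuous_pointwiseI[OF pointwise_fun_dcpo[OF Y]])
      (simp_all add: restrict_in_fun_dcpo[OF Y] assms(3,4))
qed

lemma dirac_apply [simp]: "h \<in> carrier (cont_maps R T) \<Longrightarrow> dirac R T x h = h x"
  by (simp add: dirac_def)

lemma dirac_valuation:
  assumes X: "dcpo X" and x: "x \<in> carrier X"
  shows "dirac R (scott_topology X) x \<in> carrier (val_dcpo R X)"
  using pointwise_dcpo.scott_continuous_eval[OF pointwise_fun_dcpo[OF X] x, of R]
    x
  by (simp add: valuation_iff dirac_def fun_dcpo_scale[OF X] fun_dcpo_plus[OF X])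

text \<open>Together with \<open>val_plus\<close> and the Dirac valuations this generates the
  elementary valuations, which replaces reasoning about indexed sums by induction.\<close>

definition val_scale :: "'r::d_rag itself \<Rightarrow> 'x gorder \<Rightarrow> 'r \<Rightarrow> (('x \<Rightarrow> 'r) \<Rightarrow> 'r) \<Rightarrow> ('x \<Rightarrow> 'r) \<Rightarrow> 'r"
  where "val_scale R X r \<nu> = (\<lambda>h\<in>carrier (fun_dcpo R X). r * \<nu> h)"

definition val_plus ::
    "'r::d_rag itself \<Rightarrow> 'x gorder \<Rightarrow> (('x \<Rightarrow> 'r) \<Rightarrow> 'r) \<Rightarrow> (('x \<Rightarrow> 'r) \<Rightarrow> 'r) \<Rightarrow> ('x \<Rightarrow> 'r) \<Rightarrow> 'r"
  where "val_plus R X \<mu> \<nu> = (\<lambda>h\<in>carrier (fun_dcpo R X). \<mu> h + \<nu> h)"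

text \<open>Commutativity of multiplication enters here: homogeneity requires moving the fixed
  scalar \<open>r\<close> past the scalar taken out of the integrand.\<close>

lemma val_scale_valuation:
  fixes R :: "'r::abelian_d_rag itself"
  assumes X: "dcpo X" and \<nu>: "\<nu> \<in> carrier (val_dcpo R X)"
  shows "val_scale R X r \<nu> \<in> carrier (val_dcpo R X)"
  using \<nu>
  by (simp add: valuation_iff val_scale_def mult.left_commute distrib_left
      fun_dcpo_scale[OF X] fun_dcpo_plus[OF X] scott_continuous_mult_left)

lemma val_plus_valuation:
  assumes X: "dcpo X" and "\<mu> \<in> carrier (val_dcpo R X)" "\<nu> \<in> carrier (val_dcpo R X)"
  shows "val_plus R X \<mu> \<nu> \<in> carrier (val_dcpo R X)"
  using assms(2,3)
  by (simp add: valuation_iff val_plus_def distrib_left add_ac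
      fun_dcpo_scale[OF X] fun_dcpo_plus[OF X] scott_continuous_add)

lemma scott_continuous_val_scale:
  fixes R :: "'r::abelian_d_rag itself"
  assumes X: "dcpo X"
  shows "scott_continuous (val_dcpo R X) (val_dcpo R X) (val_scale R X r)"
proof -
  interpret V: pointwise_dcpo "val_dcpo R X" "carrier (fun_dcpo R X)" R
    by (rule pointwise_val_dcpo[OF X])
  show ?thesis
    by (rule V.scott_continuous_pointwiseI[OF val_scale_valuation[OF X]])
      (simp_all add: val_scale_def scott_continuous_mult_left V.scott_continuous_eval)
qed

lemma scott_continuous_val_plus:
  assumes X: "dcpo X" and \<mu>: "\<mu> \<in> carrier (val_dcpo R X)"
  shows "scott_continuous (val_dcpo R X) (val_dcpo R X) (val_plus R X \<mu>)"
proof -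
  interpret V: pointwise_dcpo "val_dcpo R X" "carrier (fun_dcpo R X)" R
    by (rule pointwise_val_dcpo[OF X])
  show ?thesis
    by (rule V.scott_continuous_pointwiseI[OF val_plus_valuation[OF X \<mu>]])
      (simp_all add: val_plus_def scott_continuous_add V.scott_continuous_eval
        scott_continuous_const dcpo_rag)
qed

lemma val_plus_commute: "val_plus R X \<mu> \<nu> = val_plus R X \<nu> \<mu>"
  by (simp add: val_plus_def add.commute)

lemma val_plus_assoc: "val_plus R X (val_plus R X \<kappa> \<mu>) \<nu> = val_plus R X \<kappa> (val_plus R X \<mu> \<nu>)"
  by (simp add: val_plus_def add.assoc cong: restrict_cong)

lemma val_scale_plus:
  "val_scale R X r (val_plus R X \<mu> \<nu>) = val_plus R X (val_scale R X r \<mu>) (val_scale R X r \<nu>)"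
  by (simp add: val_scale_def val_plus_def distrib_left cong: restrict_cong)

lemma val_scale_scale: "val_scale R X r (val_scale R X s \<nu>) = val_scale R X (r * s) \<nu>"
  by (simp add: val_scale_def mult.assoc cong: restrict_cong)

section \<open>Elementary and minimal valuations\<close>

abbreviation elementary :: "'r::d_rag itself \<Rightarrow> 'x gorder \<Rightarrow> (('x \<Rightarrow> 'r) \<Rightarrow> 'r) set" where
  "elementary R X \<equiv> elementary_valuations R (scott_topology X)"

abbreviation minimal :: "'r::d_rag itself \<Rightarrow> 'x gorder \<Rightarrow> (('x \<Rightarrow> 'r) \<Rightarrow> 'r) set" where
  "minimal R X \<equiv> minimal_valuations R (scott_topology X)"

abbreviation point_mass :: "'r::d_rag itself \<Rightarrow> 'x gorder \<Rightarrow> 'r \<Rightarrow> 'x \<Rightarrow> ('x \<Rightarrow> 'r) \<Rightarrow> 'r" where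
  "point_mass R X r x \<equiv> val_scale R X r (dirac R (scott_topology X) x)"

lemma elementary_point:
  assumes "x \<in> carrier X"
  shows "point_mass R X r x \<in> elementary R X"
proof -
  have "point_mass R X r x = (\<lambda>h\<in>carrier (fun_dcpo R X). \<Sum>i=1..1::nat. (\<lambda>_. r) i * h ((\<lambda>_. x) i))"
    by (simp add: val_scale_def cong: restrict_cong)
  then show ?thesis
    using assms unfolding elementary_valuations_def topspace_scott_topology
    by (intro CollectI exI[of _ "1::nat"] exI[of _ "\<lambda>_. r"] exI[of _ "\<lambda>_. x"]) blast
qed

lemma elementary_plus_point:
  assumes "\<mu> \<in> elementary R X" "y \<in> carrier X"
  shows "val_plus R X \<mu> (point_mass R X s y) \<in> elementary R X"
proof -
  obtain n r x where n: "n \<ge> (1::nat)" "\<forall>i\<in>{1..n}. x i \<in> carrier X"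
    and \<mu>: "\<mu> = (\<lambda>h\<in>carrier (fun_dcpo R X). \<Sum>i=1..n. r i * h (x i))"
    using assms(1) unfolding elementary_valuations_def by auto
  \<comment> \<open>The families are changed at index \<open>Suc n\<close> only, so the sum over the
    first \<open>n\<close> indices is unaffected and the new point mass is the last term.\<close>
  define r' where "r' = r(Suc n := s)"
  define x' where "x' = x(Suc n := y)"
  have "(\<Sum>i=1..n. r' i * h (x' i)) = (\<Sum>i=1..n. r i * h (x i))" for h
    by (rule sum.cong) (auto simp: r'_def x'_def)
  then have "val_plus R X \<mu> (point_mass R X s y) =
      (\<lambda>h\<in>carrier (fun_dcpo R X). \<Sum>i=1..Suc n. r' i * h (x' i))"
    by (simp add: val_plus_def val_scale_def \<mu> r'_def x'_def cong: restrict_cong)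
  moreover have "Suc n \<ge> 1" "\<forall>i\<in>{1..Suc n}. x' i \<in> carrier X"
    using n(2) assms(2) by (auto simp: x'_def)
  ultimately show ?thesis
    unfolding elementary_valuations_def topspace_scott_topology by blast
qed

text \<open>The base case is a single point mass because \<open>n \<ge> 1\<close> in the definition.
  An empty sum would not do: in a rag the constantly zero functional may fail to be
  homogeneous.\<close>

lemma elementary_induct [consumes 1, case_names point plus]:
  assumes "\<nu> \<in> elementary R X"
    and point: "\<And>r x. x \<in> carrier X \<Longrightarrow> P (point_mass R X r x)"
    and plus: "\<And>\<mu> r x. \<lbrakk>\<mu> \<in> elementary R X; P \<mu>; x \<in> carrier X\<rbrakk> \<Longrightarrow>
      P (val_plus R X \<mu> (point_mass R X r x))"
  shows "P \<nu>"
proof -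
  obtain n r x where n: "n \<ge> (1::nat)" "\<forall>i\<in>{1..n}. x i \<in> carrier X"
    and \<nu>: "\<nu> = (\<lambda>h\<in>carrier (fun_dcpo R X). \<Sum>i=1..n. r i * h (x i))"
    using assms(1) unfolding elementary_valuations_def by auto
  \<comment> \<open>Partial sums of the given representation. Membership in
    \<open>elementary\<close> is carried along with \<open>P\<close>, since the premise
    \<open>plus\<close> asks for both.\<close>
  define \<sigma> where "\<sigma> m = (\<lambda>h\<in>carrier (fun_dcpo R X). \<Sum>i=1..m. r i * h (x i))" for m :: nat
  have "m \<le> n \<Longrightarrow> \<sigma> m \<in> elementary R X \<and> P (\<sigma> m)" if "1 \<le> m" for m
    using that
  proof (induction m rule: nat_induct_at_least)
    case base
    have "\<sigma> 1 = point_mass R X (r 1) (x 1)"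
      by (simp add: \<sigma>_def val_scale_def cong: restrict_cong)
    moreover have "x 1 \<in> carrier X"
      using n by simp
    ultimately show ?case
      by (simp only: point elementary_point)
  next
    case (Suc m)
    have "\<sigma> (Suc m) = val_plus R X (\<sigma> m) (point_mass R X (r (Suc m)) (x (Suc m)))"
      by (simp add: \<sigma>_def val_scale_def val_plus_def cong: restrict_cong)
    moreover have "x (Suc m) \<in> carrier X" "\<sigma> m \<in> elementary R X" "P (\<sigma> m)"
      using Suc n by simp_all
    ultimately show ?case
      by (simp only: plus elementary_plus_point)
  qed
  from this[OF n(1)] show ?thesis
    by (simp add: \<nu> \<sigma>_def)
qed

text \<open>Induction on the right summand; reassociating to the left turns each step into the
  addition of one more point mass.\<close>

lemma elementary_plus:
  "\<nu> \<in> elementary R X \<Longrightarrow> \<mu> \<in> elementary R X \<Longrightarrow> val_plus R X \<mu> \<nu> \<in> elementary R X"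
  by (induction rule: elementary_induct)
    (simp_all add: elementary_plus_point flip: val_plus_assoc)

lemma elementary_scale: "\<nu> \<in> elementary R X \<Longrightarrow> val_scale R X r \<nu> \<in> elementary R X"
  by (induction rule: elementary_induct)
    (simp_all add: elementary_point elementary_plus_point val_scale_scale val_scale_plus)

lemma elementary_valuation:
  fixes R :: "'r::abelian_d_rag itself"
  assumes X: "dcpo X"
  shows "\<nu> \<in> elementary R X \<Longrightarrow> \<nu> \<in> carrier (val_dcpo R X)"
  by (induction rule: elementary_induct)
    (simp_all add: X val_scale_valuation val_plus_valuation dirac_valuation)

lemma minimal_valuation:
  fixes R :: "'r::abelian_d_rag itself"
  assumes X: "dcpo X"
  shows "\<nu> \<in> minimal R X \<Longrightarrow> \<nu> \<in> carrier (val_dcpo R X)"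
  by (induction rule: minimal_valuations.induct) (simp_all add: X elementary_valuation)

text \<open>The valuations sent by \<open>F\<close> to minimal ones include the elementary ones and
  are closed under directed suprema, because \<open>F\<close> preserves both directedness and
  suprema.\<close>

lemma minimal_image:
  assumes F: "scott_continuous (val_dcpo R X) (val_dcpo R Y) F"
    and el: "\<And>\<nu>. \<nu> \<in> elementary R X \<Longrightarrow> F \<nu> \<in> minimal R Y"
  shows "\<nu> \<in> minimal R X \<Longrightarrow> F \<nu> \<in> minimal R Y"
proof (induction rule: minimal_valuations.induct)
  case (directed_lub D \<nu>)
  show ?case
    by (rule minimal_valuations.directed_lub[OF _ scott_continuous_directed[OF F directed_lub(2)]
          scott_continuous_lub[OF F directed_lub(2,3)]]) (use directed_lub(1) in blast)
qed (rule el)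

lemma minimal_scale:
  fixes R :: "'r::abelian_d_rag itself"
  assumes X: "dcpo X" and \<nu>: "\<nu> \<in> minimal R X"
  shows "val_scale R X r \<nu> \<in> minimal R X"
  by (rule minimal_image[OF scott_continuous_val_scale[OF X] _ \<nu>])
    (intro minimal_valuations.elementary elementary_scale)

lemma minimal_plus:
  fixes R :: "'r::abelian_d_rag itself"
  assumes X: "dcpo X" and \<mu>: "\<mu> \<in> minimal R X" and \<nu>: "\<nu> \<in> minimal R X"
  shows "val_plus R X \<mu> \<nu> \<in> minimal R X"
proof -
  \<comment> \<open>First stage: with an elementary left summand, addition maps elementary
    valuations to elementary ones.\<close>
  have *: "val_plus R X \<mu> \<nu> \<in> minimal R X" if \<mu>: "\<mu> \<in> elementary R X" and \<nu>: "\<nu> \<in> minimal R X" for \<mu> \<nu>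
    by (rule minimal_image[OF scott_continuous_val_plus[OF X elementary_valuation[OF X \<mu>]] _ \<nu>])
      (intro minimal_valuations.elementary elementary_plus \<mu>)
  \<comment> \<open>Second stage: the left summand is now any minimal valuation. On elementary right
    summands, commutativity of the sum reduces the claim to the first stage.\<close>
  show ?thesis
    by (rule minimal_image[OF scott_continuous_val_plus[OF X minimal_valuation[OF X \<mu>]] _ \<nu>])
      (subst val_plus_commute, rule *[OF _ \<mu>])
qed

section \<open>The dcpo of minimal valuations and its induction principle\<close>

lemma carrier_Vm: "carrier (Vm R X) = minimal R X"
  by (simp add: Vm_def)

lemma Vm_valuation:
  fixes R :: "'r::abelian_d_rag itself"
  shows "\<lbrakk>dcpo X; \<nu> \<in> carrier (Vm R X)\<rbrakk> \<Longrightarrow> \<nu> \<in> carrier (val_dcpo R X)"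
  by (simp add: carrier_Vm minimal_valuation)

lemma le_Vm [simp]: "le (Vm R X) = le (val_dcpo R X)"
  by (simp add: Vm_def)

lemma directed_Vm_imp_val:
  fixes R :: "'r::abelian_d_rag itself"
  assumes "dcpo X" "directed (Vm R X) D"
  shows "directed (val_dcpo R X) D"
  using assms Vm_valuation[OF assms(1), of _ R] unfolding directed_def by auto

text \<open>A pointwise supremum of minimal valuations is already known to be their supremum among
  all valuations, so the closure clause of \<open>minimal_valuations\<close> makes it
  minimal.\<close>

lemma pointwise_Vm:
  fixes R :: "'r::abelian_d_rag itself"
  assumes X: "dcpo X"
  shows "pointwise_dcpo (Vm R X) (carrier (fun_dcpo R X)) R"
proof -
  interpret V: pointwise_dcpo "val_dcpo R X" "carrier (fun_dcpo R X)" R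
    by (rule pointwise_val_dcpo[OF X])
  show ?thesis
  proof
    fix D s assume D: "directed (Vm R X) D" and ext: "s \<in> extensional (carrier (fun_dcpo R X))"
      and s: "\<And>h. h \<in> carrier (fun_dcpo R X) \<Longrightarrow> is_lub (rag_dcpo R) (s h) ((\<lambda>\<nu>. \<nu> h) ` D)"
    have D': "directed (val_dcpo R X) D"
      by (rule directed_Vm_imp_val[OF X D])
    have "s \<in> carrier (val_dcpo R X)"
      by (rule V.pointwise_lub_closed[OF D' ext s])
    then have "is_lub (val_dcpo R X) s D"
      by (rule V.pointwise_is_lubI[OF D' _ s])
    then show "s \<in> carrier (Vm R X)"
      using minimal_valuations.directed_lub[OF _ D'] directed_subset[OF D] by (auto simp: carrier_Vm)
  next
    show "eq (Vm R X) = (=)"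
      using V.eq_pointwise by (simp add: Vm_def)
  next
    fix f assume "f \<in> carrier (Vm R X)"
    then show "f \<in> extensional (carrier (fun_dcpo R X))"
      using Vm_valuation[OF X] V.carrier_extensional by blast
  qed (simp add: V.le_pointwise)
qed

lemma dcpo_Vm:
  fixes R :: "'r::abelian_d_rag itself"
  shows "dcpo X \<Longrightarrow> dcpo (Vm R X)"
  by (rule pointwise_dcpo.dcpo_pointwise[OF pointwise_Vm])

text \<open>Merges the inductions over elementary and minimal valuations. In the case
  \<open>plus\<close> both summands are supplied as valuations, since integrating their sections
  again needs continuity in the parameter.\<close>

lemma Vm_induct [consumes 2, case_names point plus lub]:
  fixes R :: "'r::abelian_d_rag itself"
  assumes X: "dcpo X" and \<nu>: "\<nu> \<in> carrier (Vm R X)"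
    and point: "\<And>r x. x \<in> carrier X \<Longrightarrow> P (point_mass R X r x)"
    and plus: "\<And>\<mu> \<nu>. \<lbrakk>\<mu> \<in> carrier (val_dcpo R X); \<nu> \<in> carrier (val_dcpo R X); P \<mu>; P \<nu>\<rbrakk> \<Longrightarrow>
      P (val_plus R X \<mu> \<nu>)"
    and lub: "\<And>D \<nu>. \<lbrakk>directed (val_dcpo R X) D; is_lub (val_dcpo R X) \<nu> D; \<And>d. d \<in> D \<Longrightarrow> P d\<rbrakk> \<Longrightarrow> P \<nu>"
  shows "P \<nu>"
  using \<nu> unfolding carrier_Vm
proof (induction rule: minimal_valuations.induct)
  case (elementary \<nu>)
  then show ?case
    by (induction rule: elementary_induct)
      (simp_all add: point plus X elementary_valuation val_scale_valuation dirac_valuation)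
next
  case (directed_lub D \<nu>)
  then show ?case
    using lub by blast
qed

section \<open>The monad structure\<close>

lemma
  assumes "f \<in> dcpo_hom X Y"
  shows dcpo_hom_scott_continuous: "scott_continuous X Y f"
    and dcpo_hom_closed: "x \<in> carrier X \<Longrightarrow> f x \<in> carrier Y"
    and dcpo_hom_extensional: "f \<in> extensional (carrier X)"
  using assms scott_continuous_closed[of X Y f] by (auto simp: dcpo_hom_def)

lemma restrict_in_dcpo_hom [simp]:
  "restrict f (carrier X) \<in> dcpo_hom X Y \<longleftrightarrow> scott_continuous X Y f"
  by (simp add: dcpo_hom_def)

lemma compose_in_dcpo_hom:
  "\<lbrakk>f \<in> dcpo_hom X Y; g \<in> dcpo_hom Y Z\<rbrakk> \<Longrightarrow> compose (carrier X) g f \<in> dcpo_hom X Z"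
  unfolding compose_def
  by (simp add: scott_continuous_comp[OF dcpo_hom_scott_continuous dcpo_hom_scott_continuous])

lemma dcpo_id_hom: "dcpo_id X \<in> dcpo_hom X X"
  by (simp add: dcpo_id_def scott_continuous_id)

lemma dcpo_snd_hom: "dcpo_snd X Y \<in> dcpo_hom (X \<times>\<^sub>D Y) Y"
  using scott_continuous_snd[of X Y]
  unfolding dcpo_snd_def restrict_in_dcpo_hom by (simp add: case_prod_unfold)

lemma dcpo_prod_map_hom:
  assumes "f \<in> dcpo_hom X X'" "g \<in> dcpo_hom Y Y'"
  shows "dcpo_prod_map X Y f g \<in> dcpo_hom (X \<times>\<^sub>D Y) (X' \<times>\<^sub>D Y')"
proof -
  have "scott_continuous (X \<times>\<^sub>D Y) (X' \<times>\<^sub>D Y') (\<lambda>p. (f (fst p), g (snd p)))"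
    by (intro scott_continuous_pair)
      (rule scott_continuous_comp[OF scott_continuous_fst dcpo_hom_scott_continuous[OF assms(1)]]
        scott_continuous_comp[OF scott_continuous_snd dcpo_hom_scott_continuous[OF assms(2)]])+
  then show ?thesis
    unfolding dcpo_prod_map_def restrict_in_dcpo_hom by (simp add: case_prod_unfold)
qed

lemma dcpo_assoc_hom: "dcpo_assoc X Y Z \<in> dcpo_hom ((X \<times>\<^sub>D Y) \<times>\<^sub>D Z) (X \<times>\<^sub>D (Y \<times>\<^sub>D Z))"
proof -
  have "scott_continuous ((X \<times>\<^sub>D Y) \<times>\<^sub>D Z) (X \<times>\<^sub>D (Y \<times>\<^sub>D Z)) (\<lambda>p. (fst (fst p), (snd (fst p), snd p)))"
    by (intro scott_continuous_pair)
      (rule scott_continuous_comp[OF scott_continuous_fst scott_continuous_fst]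
        scott_continuous_comp[OF scott_continuous_fst scott_continuous_snd] scott_continuous_snd)+
  then show ?thesis
    unfolding dcpo_assoc_def restrict_in_dcpo_hom by (simp add: case_prod_unfold)
qed

lemma dcpo_unit: "dcpo dcpo_unit"
  by (rule dcpoI) (auto simp: dcpo_unit_def is_lub_directed_iff directed_def)

lemma scott_continuous_Pair_left:
  "\<lbrakk>dcpo X; x \<in> carrier X\<rbrakk> \<Longrightarrow> scott_continuous Y (X \<times>\<^sub>D Y) (\<lambda>y. (x, y))"
  by (intro scott_continuous_pair scott_continuous_const scott_continuous_id)

lemma scott_continuous_Pair_right:
  "\<lbrakk>dcpo Y; y \<in> carrier Y\<rbrakk> \<Longrightarrow> scott_continuous X (X \<times>\<^sub>D Y) (\<lambda>x. (x, y))"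
  by (intro scott_continuous_pair scott_continuous_const scott_continuous_id)

lemma fun_dcpo_section_right:
  assumes "dcpo X" "dcpo Y" "h \<in> carrier (fun_dcpo R (X \<times>\<^sub>D Y))" "x \<in> carrier X"
  shows "scott_continuous Y (rag_dcpo R) (\<lambda>y. h (x, y))"
  using scott_continuous_comp[OF scott_continuous_Pair_left[OF assms(1,4)]
      fun_dcpo_scott_continuous[OF dcpo_prod[OF assms(1,2)] assms(3)]] .

lemma fun_dcpo_section_left:
  assumes "dcpo X" "dcpo Y" "h \<in> carrier (fun_dcpo R (X \<times>\<^sub>D Y))" "y \<in> carrier Y"
  shows "scott_continuous X (rag_dcpo R) (\<lambda>x. h (x, y))"
  using scott_continuous_comp[OF scott_continuous_Pair_right[OF assms(2,4)]
      fun_dcpo_scott_continuous[OF dcpo_prod[OF assms(1,2)] assms(3)]] .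

lemma fun_dcpo_compose:
  assumes "dcpo X" "dcpo Y" "h \<in> carrier (fun_dcpo R Y)" "f \<in> dcpo_hom X Y"
  shows "(\<lambda>x\<in>carrier X. h (f x)) \<in> carrier (fun_dcpo R X)"
  by (rule restrict_in_fun_dcpo[OF assms(1) scott_continuous_comp[OF
        dcpo_hom_scott_continuous[OF assms(4)] fun_dcpo_scott_continuous[OF assms(2,3)]]])

lemma Vm_eqI:
  fixes R :: "'r::abelian_d_rag itself"
  assumes "dcpo X" "\<mu> \<in> carrier (Vm R X)" "\<nu> \<in> carrier (Vm R X)"
    and "\<And>h. h \<in> carrier (fun_dcpo R X) \<Longrightarrow> \<mu> h = \<nu> h"
  shows "\<mu> = \<nu>"
  by (rule pointwise_dcpo.pointwise_eqI[OF pointwise_Vm[OF assms(1)] assms(2-4)])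

text \<open>Extensionality at two levels, for morphisms and for the valuations they return. Every
  monad and strength law thereby becomes an identity between elements of \<open>R\<close>.\<close>

lemma Vm_hom_eqI:
  fixes R :: "'r::abelian_d_rag itself"
  assumes X: "dcpo X" and F: "F \<in> dcpo_hom W (Vm R X)" and G: "G \<in> dcpo_hom W (Vm R X)"
    and "\<And>w h. \<lbrakk>w \<in> carrier W; h \<in> carrier (fun_dcpo R X)\<rbrakk> \<Longrightarrow> F w h = G w h"
  shows "F = G"
  using dcpo_hom_extensional[OF F] dcpo_hom_extensional[OF G]
  by (rule extensionalityI) (rule Vm_eqI[OF X dcpo_hom_closed[OF F] dcpo_hom_closed[OF G] assms(4)])

lemma Vm_hom_scott_continuous:
  fixes R :: "'r::abelian_d_rag itself"
  assumes "dcpo Y" "f \<in> dcpo_hom X (Vm R Y)" "k \<in> carrier (fun_dcpo R Y)"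
  shows "scott_continuous X (rag_dcpo R) (\<lambda>x. f x k)"
  using pointwise_dcpo.scott_continuous_evalI[OF pointwise_Vm[OF assms(1)]
      dcpo_hom_scott_continuous[OF assms(2)] assms(3)] .

section \<open>Integral formulas for the structure maps\<close>

lemma Vm_unit_apply:
  "\<lbrakk>x \<in> carrier X; h \<in> carrier (fun_dcpo R X)\<rbrakk> \<Longrightarrow> Vm_unit R X x h = h x"
  by (simp add: Vm_unit_def)

lemma Vm_ext_apply:
  "\<lbrakk>\<nu> \<in> carrier (Vm R X); k \<in> carrier (fun_dcpo R Y)\<rbrakk> \<Longrightarrow>
    Vm_ext R X Y f \<nu> k = \<nu> (\<lambda>x\<in>carrier X. f x k)"
  by (simp add: Vm_ext_def)

lemma Vm_map_apply:
  assumes "f \<in> dcpo_hom X Y" "\<nu> \<in> carrier (Vm R X)" "k \<in> carrier (fun_dcpo R Y)"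
  shows "Vm_map R X Y f \<nu> k = \<nu> (\<lambda>x\<in>carrier X. k (f x))"
  using assms dcpo_hom_closed[OF assms(1)]
  by (simp add: Vm_map_def Vm_ext_apply compose_eq Vm_unit_apply cong: restrict_cong)

lemma Vm_mult_apply:
  assumes "\<xi> \<in> carrier (Vm R (Vm R X))" "k \<in> carrier (fun_dcpo R X)"
  shows "Vm_mult R X \<xi> k = \<xi> (\<lambda>\<nu>\<in>carrier (Vm R X). \<nu> k)"
  using assms by (simp add: Vm_mult_def Vm_ext_apply dcpo_id_def cong: restrict_cong)

lemma Vm_strength_apply:
  assumes "x \<in> carrier X" "\<nu> \<in> carrier (Vm R Y)" "h \<in> carrier (fun_dcpo R (X \<times>\<^sub>D Y))"
  shows "Vm_strength R X Y (x, \<nu>) h = \<nu> (\<lambda>y\<in>carrier Y. h (x, y))"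
  using assms by (simp add: Vm_strength_def)

lemma Vm_dual_strength_apply:
  assumes "\<mu> \<in> carrier (Vm R X)" "y \<in> carrier Y" "h \<in> carrier (fun_dcpo R (X \<times>\<^sub>D Y))"
  shows "Vm_dual_strength R X Y (\<mu>, y) h = \<mu> (\<lambda>x\<in>carrier X. h (x, y))"
  using assms by (simp add: Vm_dual_strength_def)

lemma Vm_eval_fun_dcpo:
  fixes R :: "'r::abelian_d_rag itself"
  assumes "dcpo X" "k \<in> carrier (fun_dcpo R X)"
  shows "(\<lambda>\<nu>\<in>carrier (Vm R X). \<nu> k) \<in> carrier (fun_dcpo R (Vm R X))"
  by (rule restrict_in_fun_dcpo[OF dcpo_Vm[OF assms(1)]
        pointwise_dcpo.scott_continuous_eval[OF pointwise_Vm[OF assms(1)] assms(2)]])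

lemma Vm_unit_hom:
  fixes R :: "'r::abelian_d_rag itself"
  assumes X: "dcpo X"
  shows "Vm_unit R X \<in> dcpo_hom X (Vm R X)"
  unfolding Vm_unit_def restrict_in_dcpo_hom
proof (rule pointwise_dcpo.scott_continuous_pointwiseI[OF pointwise_Vm[OF X]])
  fix x assume x: "x \<in> carrier X"
  \<comment> \<open>The scalar \<open>1\<close> exhibits the Dirac valuation as a one-term
    elementary valuation.\<close>
  have "point_mass R X 1 x = dirac R (scott_topology X) x"
    by (simp add: val_scale_def dirac_def cong: restrict_cong)
  then show "dirac R (scott_topology X) x \<in> carrier (Vm R X)"
    using minimal_valuations.elementary[OF elementary_point[OF x, of R 1]] by (simp add: carrier_Vm)
qed (simp add: fun_dcpo_scott_continuous[OF X])

lemma Vm_ext_hom: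
  fixes R :: "'r::abelian_d_rag itself" and X :: "'x gorder" and Y :: "'y gorder"
  assumes X: "dcpo X" and Y: "dcpo Y" and f: "f \<in> dcpo_hom X (Vm R Y)"
  shows "Vm_ext R X Y f \<in> dcpo_hom (Vm R X) (Vm R Y)"
proof -
  interpret VX: pointwise_dcpo "Vm R X" "carrier (fun_dcpo R X)" R
    by (rule pointwise_Vm[OF X])
  interpret VY: pointwise_dcpo "Vm R Y" "carrier (fun_dcpo R Y)" R
    by (rule pointwise_Vm[OF Y])
  \<comment> \<open>\<open>Vm_ext\<close> is restricted to minimal valuations, whereas
    \<open>minimal_image\<close> needs a map on all valuations; \<open>F\<close> is the same formula
    without that restriction.\<close>
  define F :: "(('x \<Rightarrow> 'r) \<Rightarrow> 'r) \<Rightarrow> ('y \<Rightarrow> 'r) \<Rightarrow> 'r"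
    where "F \<nu> = (\<lambda>k\<in>carrier (fun_dcpo R Y). \<nu> (\<lambda>x\<in>carrier X. f x k))" for \<nu>
  have fx: "f x \<in> carrier (val_dcpo R Y)" if "x \<in> carrier X" for x
    using Vm_valuation[OF Y dcpo_hom_closed[OF f that]] .
  have fk: "scott_continuous X (rag_dcpo R) (\<lambda>x. f x k)" if "k \<in> carrier (fun_dcpo R Y)" for k
    using Vm_hom_scott_continuous[OF Y f that] .
  have fk': "(\<lambda>x\<in>carrier X. f x k) \<in> carrier (fun_dcpo R X)" if "k \<in> carrier (fun_dcpo R Y)" for k
    by (rule restrict_in_fun_dcpo[OF X fk[OF that]])
  \<comment> \<open>Linearity in the integrand is inherited twice: each \<open>f x\<close> is linear
    in \<open>k\<close>, and \<nu> is linear in the resulting function of \<open>x\<close>.\<close>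
  have F_val: "F \<nu> \<in> carrier (val_dcpo R Y)" if \<nu>: "\<nu> \<in> carrier (val_dcpo R X)" for \<nu>
    unfolding valuation_iff
  proof (intro conjI allI ballI)
    show "scott_continuous (fun_dcpo R Y) (rag_dcpo R) (F \<nu>)"
      unfolding F_def scott_continuous_restrict_iff
      by (rule scott_continuous_valuation_comp[OF X \<nu> fk valuation_scott_continuous[OF fx]])
  next
    fix a h assume h: "h \<in> carrier (fun_dcpo R Y)"
    have "f x (\<lambda>y\<in>carrier Y. a * h y) = a * f x h" if "x \<in> carrier X" for x
      using fx[OF that] h by (simp add: valuation_iff)
    then show "F \<nu> (\<lambda>y\<in>carrier Y. a * h y) = a * F \<nu> h"
      using h valuation_scale[OF \<nu> X fk[OF h], of a]
      by (simp add: F_def fun_dcpo_scale[OF Y] cong: restrict_cong)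
  next
    fix h k assume h: "h \<in> carrier (fun_dcpo R Y)" and k: "k \<in> carrier (fun_dcpo R Y)"
    have "f x (\<lambda>y\<in>carrier Y. h y + k y) = f x h + f x k" if "x \<in> carrier X" for x
      using fx[OF that] h k by (simp add: valuation_iff)
    then show "F \<nu> (\<lambda>y\<in>carrier Y. h y + k y) = F \<nu> h + F \<nu> k"
      using h k valuation_plus[OF \<nu> X fk[OF h] fk[OF k]]
      by (simp add: F_def fun_dcpo_plus[OF Y] cong: restrict_cong)
  qed (simp add: F_def)
  have F_cont: "scott_continuous (val_dcpo R X) (val_dcpo R Y) F"
  proof (rule pointwise_dcpo.scott_continuous_pointwiseI[OF pointwise_val_dcpo[OF Y] F_val])
    fix k assume k: "k \<in> carrier (fun_dcpo R Y)"
    show "scott_continuous (val_dcpo R X) (rag_dcpo R) (\<lambda>\<nu>. F \<nu> k)"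
      using pointwise_dcpo.scott_continuous_eval[OF pointwise_val_dcpo[OF X] fk'[OF k]] k
      by (simp add: F_def)
  qed
  \<comment> \<open>Extension sends a point mass to a multiple of \<open>f x\<close> and preserves
    sums, so elementary valuations reach minimal ones through \<open>minimal_scale\<close> and
    \<open>minimal_plus\<close>.\<close>
  have F_point: "F (point_mass R X r x) = val_scale R Y r (f x)" if "x \<in> carrier X" for r x
    using that fk' by (simp add: F_def val_scale_def cong: restrict_cong)
  have F_plus: "F (val_plus R X \<mu> \<nu>) = val_plus R Y (F \<mu>) (F \<nu>)" for \<mu> \<nu>
    using fk' by (simp add: F_def val_plus_def cong: restrict_cong)
  have point: "F (point_mass R X r x) \<in> minimal R Y" if "x \<in> carrier X" for r x
    unfolding F_point[OF that]
    using minimal_scale[OF Y] dcpo_hom_closed[OF f that] by (simp add: carrier_Vm)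
  have "F \<nu> \<in> minimal R Y" if "\<nu> \<in> elementary R X" for \<nu>
    using that
    by (induction rule: elementary_induct) (simp_all add: point F_plus minimal_plus[OF Y])
  then have F_Vm: "F \<nu> \<in> carrier (Vm R Y)" if "\<nu> \<in> carrier (Vm R X)" for \<nu>
    using minimal_image[OF F_cont] that by (simp add: carrier_Vm)
  have "scott_continuous (Vm R X) (Vm R Y) F"
  proof (rule VY.scott_continuous_pointwiseI[OF F_Vm])
    fix k assume k: "k \<in> carrier (fun_dcpo R Y)"
    show "scott_continuous (Vm R X) (rag_dcpo R) (\<lambda>\<nu>. F \<nu> k)"
      using VX.scott_continuous_eval[OF fk'[OF k]] k by (simp add: F_def)
  qed
  then show ?thesis
    unfolding Vm_ext_def F_def by simp
qed

lemma Vm_map_hom: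
  fixes R :: "'r::abelian_d_rag itself"
  assumes "dcpo X" "dcpo Y" "f \<in> dcpo_hom X Y"
  shows "Vm_map R X Y f \<in> dcpo_hom (Vm R X) (Vm R Y)"
  unfolding Vm_map_def
  by (rule Vm_ext_hom[OF assms(1,2) compose_in_dcpo_hom[OF assms(3) Vm_unit_hom[OF assms(2)]]])

lemma Vm_mult_hom:
  fixes R :: "'r::abelian_d_rag itself"
  assumes "dcpo X"
  shows "Vm_mult R X \<in> dcpo_hom (Vm R (Vm R X)) (Vm R X)"
  unfolding Vm_mult_def by (rule Vm_ext_hom[OF dcpo_Vm[OF assms] assms dcpo_id_hom])

lemma Vm_ext_unit_comp:
  fixes R :: "'r::abelian_d_rag itself"
  assumes X: "dcpo X" and Y: "dcpo Y" and f: "f \<in> dcpo_hom X (Vm R Y)"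
  shows "compose (carrier X) (Vm_ext R X Y f) (Vm_unit R X) = f"
proof (rule Vm_hom_eqI[OF Y compose_in_dcpo_hom[OF Vm_unit_hom[OF X] Vm_ext_hom[OF X Y f]] f])
  fix x k assume x: "x \<in> carrier X" and k: "k \<in> carrier (fun_dcpo R Y)"
  show "compose (carrier X) (Vm_ext R X Y f) (Vm_unit R X) x k = f x k"
    using x k dcpo_hom_closed[OF Vm_unit_hom[OF X, of R] x]
      restrict_in_fun_dcpo[OF X Vm_hom_scott_continuous[OF Y f k]]
    by (simp add: compose_eq Vm_ext_apply Vm_unit_apply)
qed

lemma Vm_ext_unit:
  fixes R :: "'r::abelian_d_rag itself"
  assumes X: "dcpo X"
  shows "Vm_ext R X X (Vm_unit R X) = dcpo_id (Vm R X)"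
proof (rule Vm_hom_eqI[OF X Vm_ext_hom[OF X X Vm_unit_hom[OF X]] dcpo_id_hom])
  fix \<nu> k assume "\<nu> \<in> carrier (Vm R X)" and k: "k \<in> carrier (fun_dcpo R X)"
  then show "Vm_ext R X X (Vm_unit R X) \<nu> k = dcpo_id (Vm R X) \<nu> k"
    using fun_dcpo_restrict[OF k]
    by (simp add: dcpo_id_def Vm_ext_apply Vm_unit_apply cong: restrict_cong)
qed

text \<open>At \<nu> and \<open>k\<close>, both sides integrate against \<nu> the function that
  sends \<open>x\<close> to the \<open>f x\<close>-integral of \<open>g y k\<close> over
  \<open>y\<close>.\<close>

lemma Vm_ext_ext:
  fixes R :: "'r::abelian_d_rag itself"
  assumes X: "dcpo X" and Y: "dcpo Y" and Z: "dcpo Z"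
    and f: "f \<in> dcpo_hom X (Vm R Y)" and g: "g \<in> dcpo_hom Y (Vm R Z)"
  shows "Vm_ext R X Z (compose (carrier X) (Vm_ext R Y Z g) f) =
    compose (carrier (Vm R X)) (Vm_ext R Y Z g) (Vm_ext R X Y f)"
proof (rule Vm_hom_eqI[OF Z])
  note ext_f = Vm_ext_hom[OF X Y f] and ext_g = Vm_ext_hom[OF Y Z g]
  show "Vm_ext R X Z (compose (carrier X) (Vm_ext R Y Z g) f) \<in> dcpo_hom (Vm R X) (Vm R Z)"
    by (rule Vm_ext_hom[OF X Z compose_in_dcpo_hom[OF f ext_g]])
  show "compose (carrier (Vm R X)) (Vm_ext R Y Z g) (Vm_ext R X Y f) \<in> dcpo_hom (Vm R X) (Vm R Z)"
    by (rule compose_in_dcpo_hom[OF ext_f ext_g])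
  fix \<nu> k assume \<nu>: "\<nu> \<in> carrier (Vm R X)" and k: "k \<in> carrier (fun_dcpo R Z)"
  show "Vm_ext R X Z (compose (carrier X) (Vm_ext R Y Z g) f) \<nu> k =
      compose (carrier (Vm R X)) (Vm_ext R Y Z g) (Vm_ext R X Y f) \<nu> k"
    using \<nu> k dcpo_hom_closed[OF f] dcpo_hom_closed[OF ext_f \<nu>]
      restrict_in_fun_dcpo[OF Y Vm_hom_scott_continuous[OF Z g k]]
    by (simp add: compose_eq Vm_ext_apply cong: restrict_cong)
qed

section \<open>The tensorial strengths\<close>

lemma Vm_strength_hom:
  fixes R :: "'r::abelian_d_rag itself"
  assumes X: "dcpo X" and Y: "dcpo Y"
  shows "Vm_strength R X Y \<in> dcpo_hom (X \<times>\<^sub>D Vm R Y) (Vm R (X \<times>\<^sub>D Y))"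
proof -
  note XY = dcpo_prod[OF X Y]
  interpret V: pointwise_dcpo "Vm R (X \<times>\<^sub>D Y)" "carrier (fun_dcpo R (X \<times>\<^sub>D Y))" R
    by (rule pointwise_Vm[OF XY])
  let ?t = "Vm_strength R X Y"
  have closed: "?t (x, \<nu>) \<in> carrier (Vm R (X \<times>\<^sub>D Y))"
    if x: "x \<in> carrier X" and \<nu>: "\<nu> \<in> carrier (Vm R Y)" for x \<nu>
  proof -
    have p: "(\<lambda>y\<in>carrier Y. (x, y)) \<in> dcpo_hom Y (X \<times>\<^sub>D Y)"
      by (simp add: scott_continuous_Pair_left[OF X x])
    note map = dcpo_hom_closed[OF Vm_map_hom[OF Y XY p] \<nu>]
    \<comment> \<open>Fixing \<open>x\<close> makes the strength a pushforward along the insertion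
      of \<open>Y\<close> at height \<open>x\<close>, so minimality of the result comes from
      \<open>Vm_map_hom\<close>.\<close>
    have "?t (x, \<nu>) = Vm_map R Y (X \<times>\<^sub>D Y) (\<lambda>y\<in>carrier Y. (x, y)) \<nu>"
    proof (rule extensionalityI[OF _ V.carrier_extensional[OF map]])
      show "?t (x, \<nu>) \<in> extensional (carrier (fun_dcpo R (X \<times>\<^sub>D Y)))"
        using x \<nu> by (simp add: Vm_strength_def)
    qed (use x \<nu> in \<open>simp add: Vm_strength_apply Vm_map_apply[OF p] cong: restrict_cong\<close>)
    then show ?thesis
      using map by simp
  qed
  \<comment> \<open>Joint continuity from separate continuity: in \<open>x\<close> it is that of a
    parametrised integral, in \<nu> that of an evaluation.\<close>
  have "scott_continuous (X \<times>\<^sub>D Vm R Y) (Vm R (X \<times>\<^sub>D Y)) ?t"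
  proof (rule scott_continuous_prodI[OF V.dcpo_pointwise])
    fix \<nu> assume \<nu>: "\<nu> \<in> carrier (Vm R Y)"
    show "scott_continuous X (Vm R (X \<times>\<^sub>D Y)) (\<lambda>x. ?t (x, \<nu>))"
    proof (rule V.scott_continuous_pointwiseI[OF closed[OF _ \<nu>]])
      fix h assume h: "h \<in> carrier (fun_dcpo R (X \<times>\<^sub>D Y))"
      have "scott_continuous X (rag_dcpo R) (\<lambda>x. \<nu> (\<lambda>y\<in>carrier Y. h (x, y)))"
        by (rule scott_continuous_valuation_comp[OF Y Vm_valuation[OF Y \<nu>]
              fun_dcpo_section_right[OF X Y h] fun_dcpo_section_left[OF X Y h]])
      then show "scott_continuous X (rag_dcpo R) (\<lambda>x. ?t (x, \<nu>) h)"
        by (rule scott_continuous_cong) (simp add: Vm_strength_apply \<nu> h)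
    qed
  next
    fix x assume x: "x \<in> carrier X"
    show "scott_continuous (Vm R Y) (Vm R (X \<times>\<^sub>D Y)) (\<lambda>\<nu>. ?t (x, \<nu>))"
    proof (rule V.scott_continuous_pointwiseI[OF closed[OF x]])
      fix h assume h: "h \<in> carrier (fun_dcpo R (X \<times>\<^sub>D Y))"
      have "scott_continuous (Vm R Y) (rag_dcpo R) (\<lambda>\<nu>. \<nu> (\<lambda>y\<in>carrier Y. h (x, y)))"
        by (rule pointwise_dcpo.scott_continuous_eval[OF pointwise_Vm[OF Y]
              restrict_in_fun_dcpo[OF Y fun_dcpo_section_right[OF X Y h x]]])
      then show "scott_continuous (Vm R Y) (rag_dcpo R) (\<lambda>\<nu>. ?t (x, \<nu>) h)"
        by (rule scott_continuous_cong) (simp add: Vm_strength_apply x h)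
    qed
  qed
  then show ?thesis
    by (simp add: dcpo_hom_def Vm_strength_def)
qed

lemma Vm_dual_strength_hom:
  fixes R :: "'r::abelian_d_rag itself"
  assumes X: "dcpo X" and Y: "dcpo Y"
  shows "Vm_dual_strength R X Y \<in> dcpo_hom (Vm R X \<times>\<^sub>D Y) (Vm R (X \<times>\<^sub>D Y))"
proof -
  note XY = dcpo_prod[OF X Y]
  \<comment> \<open>The dual strength is the strength conjugated by swaps.\<close>
  define \<sigma> where "\<sigma> = (\<lambda>p\<in>carrier (Y \<times>\<^sub>D X). (snd p, fst p))"
  define \<tau> where "\<tau> = (\<lambda>p\<in>carrier (Vm R X \<times>\<^sub>D Y). (snd p, fst p))"
  have \<sigma>: "\<sigma> \<in> dcpo_hom (Y \<times>\<^sub>D X) (X \<times>\<^sub>D Y)"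
    and \<tau>: "\<tau> \<in> dcpo_hom (Vm R X \<times>\<^sub>D Y) (Y \<times>\<^sub>D Vm R X)"
    unfolding \<sigma>_def \<tau>_def restrict_in_dcpo_hom
    by (intro scott_continuous_pair scott_continuous_fst scott_continuous_snd)+
  let ?F = "compose (carrier (Vm R X \<times>\<^sub>D Y)) (Vm_map R (Y \<times>\<^sub>D X) (X \<times>\<^sub>D Y) \<sigma>)
    (compose (carrier (Vm R X \<times>\<^sub>D Y)) (Vm_strength R Y X) \<tau>)"
  have F: "?F \<in> dcpo_hom (Vm R X \<times>\<^sub>D Y) (Vm R (X \<times>\<^sub>D Y))"
    by (rule compose_in_dcpo_hom[OF compose_in_dcpo_hom[OF \<tau> Vm_strength_hom[OF Y X]]
          Vm_map_hom[OF dcpo_prod[OF Y X] XY \<sigma>]])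
  have "Vm_dual_strength R X Y = ?F"
  proof (rule extensionalityI)
    show "Vm_dual_strength R X Y \<in> extensional (carrier (Vm R X \<times>\<^sub>D Y))"
      by (simp add: Vm_dual_strength_def)
    show "?F \<in> extensional (carrier (Vm R X \<times>\<^sub>D Y))"
      by (rule compose_extensional)
    fix p assume p: "p \<in> carrier (Vm R X \<times>\<^sub>D Y)"
    then obtain \<mu> y where \<mu>y: "p = (\<mu>, y)" "\<mu> \<in> carrier (Vm R X)" "y \<in> carrier Y"
      by auto
    show "Vm_dual_strength R X Y p = ?F p"
    proof (rule extensionalityI)
      show "Vm_dual_strength R X Y p \<in> extensional (carrier (fun_dcpo R (X \<times>\<^sub>D Y)))"
        using \<mu>y by (simp add: Vm_dual_strength_def)
      show "?F p \<in> extensional (carrier (fun_dcpo R (X \<times>\<^sub>D Y)))"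
        using pointwise_dcpo.carrier_extensional[OF pointwise_Vm[OF XY] dcpo_hom_closed[OF F p]] .
      fix h assume h: "h \<in> carrier (fun_dcpo R (X \<times>\<^sub>D Y))"
      have t: "Vm_strength R Y X (y, \<mu>) \<in> carrier (Vm R (Y \<times>\<^sub>D X))"
        by (rule dcpo_hom_closed[OF Vm_strength_hom[OF Y X]]) (simp add: \<mu>y)
      have "?F p h = \<mu> (\<lambda>x\<in>carrier X. h (x, y))"
        using \<mu>y h t fun_dcpo_compose[OF dcpo_prod[OF Y X] XY h \<sigma>]
        by (simp add: compose_eq \<tau>_def Vm_map_apply[OF \<sigma>] Vm_strength_apply)
          (simp add: \<sigma>_def cong: restrict_cong)
      then show "Vm_dual_strength R X Y p h = ?F p h"
        using \<mu>y h by (simp add: Vm_dual_strength_apply)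
    qed
  qed
  then show ?thesis
    using F by simp
qed

section \<open>Naturality and Moggi's coherence conditions for the strength\<close>

lemma Vm_strength_natural:
  fixes R :: "'r::abelian_d_rag itself"
  assumes X: "dcpo X" and Y: "dcpo Y" and X': "dcpo X'" and Y': "dcpo Y'"
    and f: "f \<in> dcpo_hom X X'" and g: "g \<in> dcpo_hom Y Y'"
  shows "compose (carrier (X \<times>\<^sub>D Vm R Y))
      (Vm_map R (X \<times>\<^sub>D Y) (X' \<times>\<^sub>D Y') (dcpo_prod_map X Y f g)) (Vm_strength R X Y) =
    compose (carrier (X \<times>\<^sub>D Vm R Y))
      (Vm_strength R X' Y') (dcpo_prod_map X (Vm R Y) f (Vm_map R Y Y' g))"
    (is "?L = ?R")
proof (rule Vm_hom_eqI[OF dcpo_prod[OF X' Y']])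
  note XY = dcpo_prod[OF X Y] and XY' = dcpo_prod[OF X' Y']
  note fg = dcpo_prod_map_hom[OF f g] and t = Vm_strength_hom[OF X Y, of R]
  note Tg = Vm_map_hom[OF Y Y' g, of R]
  show "?L \<in> dcpo_hom (X \<times>\<^sub>D Vm R Y) (Vm R (X' \<times>\<^sub>D Y'))"
    by (rule compose_in_dcpo_hom[OF t Vm_map_hom[OF XY XY' fg]])
  show "?R \<in> dcpo_hom (X \<times>\<^sub>D Vm R Y) (Vm R (X' \<times>\<^sub>D Y'))"
    by (rule compose_in_dcpo_hom[OF dcpo_prod_map_hom[OF f Tg] Vm_strength_hom[OF X' Y']])
  fix w h assume w: "w \<in> carrier (X \<times>\<^sub>D Vm R Y)" and h: "h \<in> carrier (fun_dcpo R (X' \<times>\<^sub>D Y'))"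
  then obtain x \<nu> where x: "w = (x, \<nu>)" "x \<in> carrier X" "\<nu> \<in> carrier (Vm R Y)"
    by auto
  \<comment> \<open>The functor action precomposes \<open>h\<close> with the product map; only then
    is \<open>dcpo_prod_map\<close> itself evaluated, inside the section over
    \<open>Y\<close>.\<close>
  have "?L w h = \<nu> (\<lambda>y\<in>carrier Y. h (f x, g y))"
    using x h dcpo_hom_closed[OF t w] fun_dcpo_compose[OF XY XY' h fg]
    by (simp add: compose_eq Vm_map_apply[OF fg] Vm_strength_apply)
      (simp add: dcpo_prod_map_def cong: restrict_cong)
  moreover have "?R w h = \<nu> (\<lambda>y\<in>carrier Y. h (f x, g y))"
    using x h dcpo_hom_closed[OF f x(2)] dcpo_hom_closed[OF g] dcpo_hom_closed[OF Tg x(3)]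
      restrict_in_fun_dcpo[OF Y' fun_dcpo_section_right[OF X' Y' h dcpo_hom_closed[OF f x(2)]]]
    by (simp add: compose_eq dcpo_prod_map_def Vm_strength_apply Vm_map_apply[OF g] cong: restrict_cong)
  ultimately show "?L w h = ?R w h"
    by simp
qed

text \<open>Coherence with the left unitor, which for the cartesian product is the second projection
  out of the product with the terminal object.\<close>

lemma Vm_strength_unit:
  fixes R :: "'r::abelian_d_rag itself"
  assumes Y: "dcpo Y"
  shows "compose (carrier (dcpo_unit \<times>\<^sub>D Vm R Y))
      (Vm_map R (dcpo_unit \<times>\<^sub>D Y) Y (dcpo_snd dcpo_unit Y)) (Vm_strength R dcpo_unit Y) =
    dcpo_snd dcpo_unit (Vm R Y)"
    (is "?L = ?R")
proof (rule Vm_hom_eqI[OF Y _ dcpo_snd_hom])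
  note UY = dcpo_prod[OF dcpo_unit Y]
  note t = Vm_strength_hom[OF dcpo_unit Y, of R]
  show "?L \<in> dcpo_hom (dcpo_unit \<times>\<^sub>D Vm R Y) (Vm R Y)"
    by (rule compose_in_dcpo_hom[OF t Vm_map_hom[OF UY Y dcpo_snd_hom]])
  fix w h assume w: "w \<in> carrier (dcpo_unit \<times>\<^sub>D Vm R Y)" and h: "h \<in> carrier (fun_dcpo R Y)"
  then obtain u \<nu> where x: "w = (u, \<nu>)" "u \<in> carrier dcpo_unit" "\<nu> \<in> carrier (Vm R Y)"
    by auto
  have "?L w h = \<nu> (\<lambda>y\<in>carrier Y. h y)"
    using x h dcpo_hom_closed[OF t w] fun_dcpo_compose[OF UY Y h dcpo_snd_hom]
    by (simp add: compose_eq Vm_map_apply[OF dcpo_snd_hom] Vm_strength_apply)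
      (simp add: dcpo_snd_def cong: restrict_cong)
  then show "?L w h = ?R w h"
    using x fun_dcpo_restrict[OF h] by (simp add: dcpo_snd_def)
qed

text \<open>Coherence with the associator. Either way, \<nu> integrates \<open>h (x, (y, z))\<close>
  over \<open>z\<close> alone.\<close>

lemma Vm_strength_assoc:
  fixes R :: "'r::abelian_d_rag itself"
  assumes X: "dcpo X" and Y: "dcpo Y" and Z: "dcpo Z"
  shows "compose (carrier ((X \<times>\<^sub>D Y) \<times>\<^sub>D Vm R Z))
      (Vm_map R ((X \<times>\<^sub>D Y) \<times>\<^sub>D Z) (X \<times>\<^sub>D (Y \<times>\<^sub>D Z)) (dcpo_assoc X Y Z))
      (Vm_strength R (X \<times>\<^sub>D Y) Z) =
    compose (carrier ((X \<times>\<^sub>D Y) \<times>\<^sub>D Vm R Z))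
      (compose (carrier (X \<times>\<^sub>D (Y \<times>\<^sub>D Vm R Z)))
        (Vm_strength R X (Y \<times>\<^sub>D Z))
        (dcpo_prod_map X (Y \<times>\<^sub>D Vm R Z) (dcpo_id X) (Vm_strength R Y Z)))
      (dcpo_assoc X Y (Vm R Z))"
    (is "?L = ?R")
proof (rule Vm_hom_eqI)
  note YZ = dcpo_prod[OF Y Z] and XY_Z = dcpo_prod[OF dcpo_prod[OF X Y] Z]
  note X_YZ = dcpo_prod[OF X YZ]
  note t = Vm_strength_hom[OF dcpo_prod[OF X Y] Z, of R] and tYZ = Vm_strength_hom[OF Y Z, of R]
  show "dcpo (X \<times>\<^sub>D (Y \<times>\<^sub>D Z))"
    by (rule X_YZ)
  show "?L \<in> dcpo_hom ((X \<times>\<^sub>D Y) \<times>\<^sub>D Vm R Z) (Vm R (X \<times>\<^sub>D (Y \<times>\<^sub>D Z)))"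
    by (rule compose_in_dcpo_hom[OF t Vm_map_hom[OF XY_Z X_YZ dcpo_assoc_hom]])
  show "?R \<in> dcpo_hom ((X \<times>\<^sub>D Y) \<times>\<^sub>D Vm R Z) (Vm R (X \<times>\<^sub>D (Y \<times>\<^sub>D Z)))"
    by (rule compose_in_dcpo_hom[OF dcpo_assoc_hom compose_in_dcpo_hom[OF
            dcpo_prod_map_hom[OF dcpo_id_hom tYZ] Vm_strength_hom[OF X YZ]]])
  fix w h assume w: "w \<in> carrier ((X \<times>\<^sub>D Y) \<times>\<^sub>D Vm R Z)"
    and h: "h \<in> carrier (fun_dcpo R (X \<times>\<^sub>D (Y \<times>\<^sub>D Z)))"
  then obtain x y \<nu> where x: "w = ((x, y), \<nu>)" "x \<in> carrier X" "y \<in> carrier Y" "\<nu> \<in> carrier (Vm R Z)"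
    by auto
  have "?L w h = \<nu> (\<lambda>z\<in>carrier Z. h (x, (y, z)))"
    using x h dcpo_hom_closed[OF t w] fun_dcpo_compose[OF XY_Z X_YZ h dcpo_assoc_hom]
    by (simp add: compose_eq Vm_map_apply[OF dcpo_assoc_hom] Vm_strength_apply)
      (simp add: dcpo_assoc_def cong: restrict_cong)
  moreover have "?R w h = \<nu> (\<lambda>z\<in>carrier Z. h (x, (y, z)))"
    using x h dcpo_hom_closed[OF tYZ, of "(y, \<nu>)"]
      restrict_in_fun_dcpo[OF YZ fun_dcpo_section_right[OF X YZ h x(2)]]
    by (simp add: compose_eq dcpo_assoc_def dcpo_prod_map_def dcpo_id_def Vm_strength_apply
        cong: restrict_cong)
  ultimately show "?L w h = ?R w h"
    by simp
qed

text \<open>Coherence with the unit. Integrating the section of \<open>h\<close> at \<open>x\<close>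
  against the Dirac valuation at \<open>y\<close> leaves \<open>h (x, y)\<close>.\<close>

lemma Vm_strength_eta:
  fixes R :: "'r::abelian_d_rag itself"
  assumes X: "dcpo X" and Y: "dcpo Y"
  shows "compose (carrier (X \<times>\<^sub>D Y))
      (Vm_strength R X Y) (dcpo_prod_map X Y (dcpo_id X) (Vm_unit R Y)) =
    Vm_unit R (X \<times>\<^sub>D Y)"
    (is "?L = ?R")
proof (rule Vm_hom_eqI[OF dcpo_prod[OF X Y] _ Vm_unit_hom[OF dcpo_prod[OF X Y]]])
  note \<eta> = Vm_unit_hom[OF Y, of R]
  show "?L \<in> dcpo_hom (X \<times>\<^sub>D Y) (Vm R (X \<times>\<^sub>D Y))"
    by (rule compose_in_dcpo_hom[OF dcpo_prod_map_hom[OF dcpo_id_hom \<eta>] Vm_strength_hom[OF X Y]])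
  fix w h assume w: "w \<in> carrier (X \<times>\<^sub>D Y)" and h: "h \<in> carrier (fun_dcpo R (X \<times>\<^sub>D Y))"
  then obtain x y where x: "w = (x, y)" "x \<in> carrier X" "y \<in> carrier Y"
    by auto
  show "?L w h = ?R w h"
    using x h dcpo_hom_closed[OF \<eta> x(3)]
      restrict_in_fun_dcpo[OF Y fun_dcpo_section_right[OF X Y h x(2)]]
    by (simp add: compose_eq dcpo_prod_map_def dcpo_id_def Vm_strength_apply Vm_unit_apply)
qed

text \<open>Coherence with the multiplication. Both sides integrate against \<xi> the function that
  sends \<nu> to the \<nu>-integral of \<open>h (x, y)\<close> over \<open>y\<close>.\<close>

lemma Vm_strength_mult:
  fixes R :: "'r::abelian_d_rag itself"
  assumes X: "dcpo X" and Y: "dcpo Y"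
  shows "compose (carrier (X \<times>\<^sub>D Vm R (Vm R Y)))
      (Vm_strength R X Y) (dcpo_prod_map X (Vm R (Vm R Y)) (dcpo_id X) (Vm_mult R Y)) =
    compose (carrier (X \<times>\<^sub>D Vm R (Vm R Y)))
      (compose (carrier (Vm R (X \<times>\<^sub>D Vm R Y)))
        (Vm_mult R (X \<times>\<^sub>D Y))
        (Vm_map R (X \<times>\<^sub>D Vm R Y) (Vm R (X \<times>\<^sub>D Y)) (Vm_strength R X Y)))
      (Vm_strength R X (Vm R Y))"
    (is "?L = ?R")
proof (rule Vm_hom_eqI)
  note XY = dcpo_prod[OF X Y] and VY = dcpo_Vm[OF Y, of R]
  note XVY = dcpo_prod[OF X VY] and VXY = dcpo_Vm[OF XY, of R]
  note t = Vm_strength_hom[OF X Y, of R] and t' = Vm_strength_hom[OF X VY, of R]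
  note m = Vm_mult_hom[OF Y, of R] and Tt = Vm_map_hom[OF XVY VXY t]
  show "dcpo (X \<times>\<^sub>D Y)"
    by (rule XY)
  show "?L \<in> dcpo_hom (X \<times>\<^sub>D Vm R (Vm R Y)) (Vm R (X \<times>\<^sub>D Y))"
    by (rule compose_in_dcpo_hom[OF dcpo_prod_map_hom[OF dcpo_id_hom m] t])
  show "?R \<in> dcpo_hom (X \<times>\<^sub>D Vm R (Vm R Y)) (Vm R (X \<times>\<^sub>D Y))"
    by (rule compose_in_dcpo_hom[OF t' compose_in_dcpo_hom[OF Tt Vm_mult_hom[OF XY]]])
  fix w h assume w: "w \<in> carrier (X \<times>\<^sub>D Vm R (Vm R Y))" and h: "h \<in> carrier (fun_dcpo R (X \<times>\<^sub>D Y))"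
  then obtain x \<xi> where x: "w = (x, \<xi>)" "x \<in> carrier X" "\<xi> \<in> carrier (Vm R (Vm R Y))"
    by auto
  have "?L w h = \<xi> (\<lambda>\<nu>\<in>carrier (Vm R Y). \<nu> (\<lambda>y\<in>carrier Y. h (x, y)))"
    using x h dcpo_hom_closed[OF m x(3)] restrict_in_fun_dcpo[OF Y fun_dcpo_section_right[OF X Y h x(2)]]
    by (simp add: compose_eq dcpo_prod_map_def dcpo_id_def Vm_strength_apply Vm_mult_apply)
  \<comment> \<open>The right side is unwound from the outside: the multiplication feeds in
    evaluation at \<open>h\<close>, the functor action precomposes it with the strength, and the
    outer strength fixes \<open>x\<close>.\<close>
  moreover have "?R w h = Vm_map R (X \<times>\<^sub>D Vm R Y) (Vm R (X \<times>\<^sub>D Y)) (Vm_strength R X Y)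
      (Vm_strength R X (Vm R Y) w) (\<lambda>\<omega>\<in>carrier (Vm R (X \<times>\<^sub>D Y)). \<omega> h)"
    using w h dcpo_hom_closed[OF t' w] dcpo_hom_closed[OF Tt dcpo_hom_closed[OF t' w]]
    by (simp add: compose_eq Vm_mult_apply)
  moreover have "\<dots> = Vm_strength R X (Vm R Y) w
      (\<lambda>p\<in>carrier (X \<times>\<^sub>D Vm R Y). (\<lambda>\<omega>\<in>carrier (Vm R (X \<times>\<^sub>D Y)). \<omega> h) (Vm_strength R X Y p))"
    by (rule Vm_map_apply[OF t dcpo_hom_closed[OF t' w] Vm_eval_fun_dcpo[OF XY h]])
  moreover have "\<dots> = \<xi> (\<lambda>\<nu>\<in>carrier (Vm R Y). \<nu> (\<lambda>y\<in>carrier Y. h (x, y)))"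
    using x h dcpo_hom_closed[OF t] fun_dcpo_compose[OF XVY VXY Vm_eval_fun_dcpo[OF XY h] t]
    by (simp add: Vm_strength_apply cong: restrict_cong)
  ultimately show "?L w h = ?R w h"
    by simp
qed

section \<open>Commutativity\<close>

text \<open>Only \<mu> is decomposed into point masses, sums and directed suprema; \<nu> contributes
  its linearity and Scott continuity and may be any valuation.\<close>

lemma Vm_fubini:
  fixes R :: "'r::abelian_d_rag itself"
  assumes X: "dcpo X" and Y: "dcpo Y" and \<mu>: "\<mu> \<in> carrier (Vm R X)"
    and \<nu>: "\<nu> \<in> carrier (val_dcpo R Y)" and h: "h \<in> carrier (fun_dcpo R (X \<times>\<^sub>D Y))"
  shows "\<mu> (\<lambda>x\<in>carrier X. \<nu> (\<lambda>y\<in>carrier Y. h (x, y))) = \<nu> (\<lambda>y\<in>carrier Y. \<mu> (\<lambda>x\<in>carrier X. h (x, y)))"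
proof -
  note hx = fun_dcpo_section_right[OF X Y h] and hy = fun_dcpo_section_left[OF X Y h]
  \<comment> \<open>The inner integrals must themselves be admissible integrands; this fact and
    \<open>cont\<close> provide that for the two orders of integration.\<close>
  have k: "(\<lambda>x\<in>carrier X. \<nu> (\<lambda>y\<in>carrier Y. h (x, y))) \<in> carrier (fun_dcpo R X)"
    by (rule restrict_in_fun_dcpo[OF X scott_continuous_valuation_comp[OF Y \<nu> hx hy]])
  have hy': "(\<lambda>x\<in>carrier X. h (x, y)) \<in> carrier (fun_dcpo R X)" if "y \<in> carrier Y" for y
    by (rule restrict_in_fun_dcpo[OF X hy[OF that]])
  have cont: "scott_continuous Y (rag_dcpo R) (\<lambda>y. \<mu> (\<lambda>x\<in>carrier X. h (x, y)))"
    if "\<mu> \<in> carrier (val_dcpo R X)" for \<mu>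
    by (rule scott_continuous_valuation_comp[OF X that hy hx])
  show ?thesis
    using X \<mu>
  proof (induction rule: Vm_induct)
    case (point r x)
    have "point_mass R X r x (\<lambda>x\<in>carrier X. h (x, y)) = r * h (x, y)" if "y \<in> carrier Y" for y
      unfolding val_scale_def using point by (simp add: hy'[OF that])
    then have "\<nu> (\<lambda>y\<in>carrier Y. point_mass R X r x (\<lambda>x\<in>carrier X. h (x, y))) =
        r * \<nu> (\<lambda>y\<in>carrier Y. h (x, y))"
      using valuation_scale[OF \<nu> Y hx[OF point], of r] by (simp cong: restrict_cong)
    moreover have "point_mass R X r x (\<lambda>x\<in>carrier X. \<nu> (\<lambda>y\<in>carrier Y. h (x, y))) =
        r * \<nu> (\<lambda>y\<in>carrier Y. h (x, y))"
      unfolding val_scale_def using point by (simp add: k)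
    ultimately show ?case
      by (simp only:)
  next
    case (plus \<mu> \<mu>')
    have "val_plus R X \<mu> \<mu>' (\<lambda>x\<in>carrier X. h (x, y)) =
        \<mu> (\<lambda>x\<in>carrier X. h (x, y)) + \<mu>' (\<lambda>x\<in>carrier X. h (x, y))" if "y \<in> carrier Y" for y
      unfolding val_plus_def by (simp add: hy'[OF that])
    then have "\<nu> (\<lambda>y\<in>carrier Y. val_plus R X \<mu> \<mu>' (\<lambda>x\<in>carrier X. h (x, y))) =
        \<nu> (\<lambda>y\<in>carrier Y. \<mu> (\<lambda>x\<in>carrier X. h (x, y))) +
        \<nu> (\<lambda>y\<in>carrier Y. \<mu>' (\<lambda>x\<in>carrier X. h (x, y)))"
      using valuation_plus[OF \<nu> Y cont[OF plus(1)] cont[OF plus(2)]] by (simp cong: restrict_cong)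
    moreover have "val_plus R X \<mu> \<mu>' (\<lambda>x\<in>carrier X. \<nu> (\<lambda>y\<in>carrier Y. h (x, y))) =
        \<mu> (\<lambda>x\<in>carrier X. \<nu> (\<lambda>y\<in>carrier Y. h (x, y))) +
        \<mu>' (\<lambda>x\<in>carrier X. \<nu> (\<lambda>y\<in>carrier Y. h (x, y)))"
      unfolding val_plus_def by (simp add: k)
    ultimately show ?case
      using plus(3,4) by (simp only:)
  next
    case (lub D \<mu>)
    note eval = pointwise_dcpo.scott_continuous_eval[OF pointwise_val_dcpo[OF X]]
    \<comment> \<open>One side of the formula is evaluation of \<mu> at a fixed integrand. For the
      other, \<mu> itself is the parameter of a \<nu>-integral, so both sides are Scott-continuous
      in \<mu> and agree at the supremum.\<close>
    have "scott_continuous (val_dcpo R X) (rag_dcpo R)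
        (\<lambda>\<mu>. \<nu> (\<lambda>y\<in>carrier Y. \<mu> (\<lambda>x\<in>carrier X. h (x, y))))"
      by (rule scott_continuous_valuation_comp[OF Y \<nu>]) (simp_all only: cont eval[OF hy'])
    then show ?case
      using scott_continuous_eq_at_lub[OF dcpo_rag eval[OF k] _ lub(1,2)] lub(3) by blast
  qed
qed

text \<open>Evaluated at \<open>h\<close>, the left composite integrates first against \<mu> and
  then against \<nu>, the right one in the opposite order; \<open>Vm_fubini\<close> identifies
  them.\<close>

lemma Vm_commutative:
  fixes R :: "'r::abelian_d_rag itself"
  assumes X: "dcpo X" and Y: "dcpo Y"
  shows "compose (carrier (Vm R X \<times>\<^sub>D Vm R Y))
      (Vm_ext R (Vm R X \<times>\<^sub>D Y) (X \<times>\<^sub>D Y) (Vm_dual_strength R X Y))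
      (Vm_strength R (Vm R X) Y) =
    compose (carrier (Vm R X \<times>\<^sub>D Vm R Y))
      (Vm_ext R (X \<times>\<^sub>D Vm R Y) (X \<times>\<^sub>D Y) (Vm_strength R X Y))
      (Vm_dual_strength R X (Vm R Y))"
    (is "?L = ?R")
proof (rule Vm_hom_eqI)
  note XY = dcpo_prod[OF X Y] and VX = dcpo_Vm[OF X, of R] and VY = dcpo_Vm[OF Y, of R]
  note VXY = dcpo_prod[OF VX Y] and XVY = dcpo_prod[OF X VY]
  note t = Vm_strength_hom[OF X Y, of R] and d = Vm_dual_strength_hom[OF X Y, of R]
  note t' = Vm_strength_hom[OF VX Y, of R] and d' = Vm_dual_strength_hom[OF X VY, of R]
  show "dcpo (X \<times>\<^sub>D Y)"
    by (rule XY)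
  show "?L \<in> dcpo_hom (Vm R X \<times>\<^sub>D Vm R Y) (Vm R (X \<times>\<^sub>D Y))"
    by (rule compose_in_dcpo_hom[OF t' Vm_ext_hom[OF VXY XY d]])
  show "?R \<in> dcpo_hom (Vm R X \<times>\<^sub>D Vm R Y) (Vm R (X \<times>\<^sub>D Y))"
    by (rule compose_in_dcpo_hom[OF d' Vm_ext_hom[OF XVY XY t]])
  fix w h assume w: "w \<in> carrier (Vm R X \<times>\<^sub>D Vm R Y)" and h: "h \<in> carrier (fun_dcpo R (X \<times>\<^sub>D Y))"
  then obtain \<mu> \<nu> where x: "w = (\<mu>, \<nu>)" "\<mu> \<in> carrier (Vm R X)" "\<nu> \<in> carrier (Vm R Y)"
    by auto
  have "?L w h = \<nu> (\<lambda>y\<in>carrier Y. \<mu> (\<lambda>x\<in>carrier X. h (x, y)))"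
    using x h dcpo_hom_closed[OF t' w] restrict_in_fun_dcpo[OF VXY Vm_hom_scott_continuous[OF XY d h]]
    by (simp add: compose_eq Vm_ext_apply Vm_strength_apply Vm_dual_strength_apply cong: restrict_cong)
  moreover have "?R w h = \<mu> (\<lambda>x\<in>carrier X. \<nu> (\<lambda>y\<in>carrier Y. h (x, y)))"
    using x h dcpo_hom_closed[OF d' w] restrict_in_fun_dcpo[OF XVY Vm_hom_scott_continuous[OF XY t h]]
    by (simp add: compose_eq Vm_ext_apply Vm_strength_apply Vm_dual_strength_apply cong: restrict_cong)
  ultimately show "?L w h = ?R w h"
    using Vm_fubini[OF X Y x(2) Vm_valuation[OF Y x(3)] h] by simp
qed

text \<open>The conjuncts fall into three groups: the Kleisli triple, the strength with naturality
  and coherence expressed through the induced \<open>Vm_map\<close> and \<open>Vm_mult\<close>, and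
  finally the dual strength with commutativity. Since morphisms are extensional, all laws are plain
  HOL equations.\<close>

theorem corollary5p11:
  fixes R :: "'r::abelian_d_rag itself"
    and X :: "'x gorder" and Y :: "'y gorder" and Z :: "'z gorder"
    and X' :: "'x1 gorder" and Y' :: "'y1 gorder"
  assumes "dcpo X" and "dcpo Y" and "dcpo Z" and "dcpo X'" and "dcpo Y'"
  shows
    "dcpo (Vm R X) \<and>
     Vm_unit R X \<in> dcpo_hom X (Vm R X) \<and>
     (\<forall>f \<in> dcpo_hom X (Vm R Y). Vm_ext R X Y f \<in> dcpo_hom (Vm R X) (Vm R Y)) \<and>
     (\<forall>f \<in> dcpo_hom X (Vm R Y). compose (carrier X) (Vm_ext R X Y f) (Vm_unit R X) = f) \<and>
     Vm_ext R X X (Vm_unit R X) = dcpo_id (Vm R X) \<and>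
     (\<forall>f \<in> dcpo_hom X (Vm R Y). \<forall>g \<in> dcpo_hom Y (Vm R Z).
        Vm_ext R X Z (compose (carrier X) (Vm_ext R Y Z g) f) =
        compose (carrier (Vm R X)) (Vm_ext R Y Z g) (Vm_ext R X Y f)) \<and>

     Vm_strength R X Y \<in> dcpo_hom (X \<times>\<^sub>D Vm R Y) (Vm R (X \<times>\<^sub>D Y)) \<and>
     (\<forall>f \<in> dcpo_hom X X'. \<forall>g \<in> dcpo_hom Y Y'.
        compose (carrier (X \<times>\<^sub>D Vm R Y))
          (Vm_map R (X \<times>\<^sub>D Y) (X' \<times>\<^sub>D Y') (dcpo_prod_map X Y f g)) (Vm_strength R X Y) =
        compose (carrier (X \<times>\<^sub>D Vm R Y))
          (Vm_strength R X' Y') (dcpo_prod_map X (Vm R Y) f (Vm_map R Y Y' g))) \<and>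
     compose (carrier (dcpo_unit \<times>\<^sub>D Vm R Y))
       (Vm_map R (dcpo_unit \<times>\<^sub>D Y) Y (dcpo_snd dcpo_unit Y)) (Vm_strength R dcpo_unit Y) =
     dcpo_snd dcpo_unit (Vm R Y) \<and>
     compose (carrier ((X \<times>\<^sub>D Y) \<times>\<^sub>D Vm R Z))
       (Vm_map R ((X \<times>\<^sub>D Y) \<times>\<^sub>D Z) (X \<times>\<^sub>D (Y \<times>\<^sub>D Z)) (dcpo_assoc X Y Z))
       (Vm_strength R (X \<times>\<^sub>D Y) Z) =
     compose (carrier ((X \<times>\<^sub>D Y) \<times>\<^sub>D Vm R Z))
       (compose (carrier (X \<times>\<^sub>D (Y \<times>\<^sub>D Vm R Z)))
         (Vm_strength R X (Y \<times>\<^sub>D Z))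
         (dcpo_prod_map X (Y \<times>\<^sub>D Vm R Z) (dcpo_id X) (Vm_strength R Y Z)))
       (dcpo_assoc X Y (Vm R Z)) \<and>
     compose (carrier (X \<times>\<^sub>D Y))
       (Vm_strength R X Y) (dcpo_prod_map X Y (dcpo_id X) (Vm_unit R Y)) =
     Vm_unit R (X \<times>\<^sub>D Y) \<and>
     compose (carrier (X \<times>\<^sub>D Vm R (Vm R Y)))
       (Vm_strength R X Y) (dcpo_prod_map X (Vm R (Vm R Y)) (dcpo_id X) (Vm_mult R Y)) =
     compose (carrier (X \<times>\<^sub>D Vm R (Vm R Y)))
       (compose (carrier (Vm R (X \<times>\<^sub>D Vm R Y)))
         (Vm_mult R (X \<times>\<^sub>D Y))
         (Vm_map R (X \<times>\<^sub>D Vm R Y) (Vm R (X \<times>\<^sub>D Y)) (Vm_strength R X Y)))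
       (Vm_strength R X (Vm R Y)) \<and>

     Vm_dual_strength R X Y \<in> dcpo_hom (Vm R X \<times>\<^sub>D Y) (Vm R (X \<times>\<^sub>D Y)) \<and>
     compose (carrier (Vm R X \<times>\<^sub>D Vm R Y))
       (Vm_ext R (Vm R X \<times>\<^sub>D Y) (X \<times>\<^sub>D Y) (Vm_dual_strength R X Y))
       (Vm_strength R (Vm R X) Y) =
     compose (carrier (Vm R X \<times>\<^sub>D Vm R Y))
       (Vm_ext R (X \<times>\<^sub>D Vm R Y) (X \<times>\<^sub>D Y) (Vm_strength R X Y))
       (Vm_dual_strength R X (Vm R Y))"
  by (intro conjI ballI dcpo_Vm Vm_unit_hom Vm_ext_hom Vm_ext_unit_comp Vm_ext_unit Vm_ext_ext
      Vm_strength_hom Vm_strength_natural Vm_strength_unit Vm_strength_assoc Vm_strength_eta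
      Vm_strength_mult Vm_dual_strength_hom Vm_commutative assms)

end
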